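(* Let $S=(X,\{(V_i,C_i)\}_{i=1}^m)$ be a $k$-ary constraint system and let $\pi$ be a probability distribution on $[m]\times[m]$. There is a $*$-isomorphism $\alpha:\mathcal{A}_{c-c}(B(S))\to\mathcal{A}_{c-c}(S)$ such that $\alpha$ and $\alpha^{-1}$ are $1$-homomorphisms between $\mathcal{A}_{c-c}(B(S),\pi)$ and $\mathcal{A}_{c-c}(S,\pi)$, where $B(S)$ is the boolean form of $S$.
   Context: A $k$-ary constraint system is $S=(X,\{(V_i,C_i)\}_{i=1}^m)$ with $X$ a finite set of variables, $V_i\subseteq X$, $C_i\subseteq\mathbb{Z}_k^{V_i}$, $\mathbb{Z}_k=\{0,\dots,k-1\}$. Its boolean form is the $2$-ary constraint system $B(S)=(X',\{(V_i',C_i')\}_{i=1}^m)$ with $X'=X\times\mathbb{Z}_k$, $V_i'=V_i\times\mathbb{Z}_k$, and $C_i'=\{\phi':\phi\in C_i\}$, where $\phi'(x,a)=1$ if $\phi(x)=a$ and $0$ otherwise. Algebras. $*$-algebras are complex and unital. $\mathbb{C}\mathbb{Z}_k^V$ is the commutative $*$-algebra generated by commuting unitaries $x\in V$ with $x^k=1$. $\Pi_a(x)=\frac1k\sum_{n=0}^{k-1}\omega_k^{-na}x^n$, $\omega_k=e^{2\pi i/k}$; $\Phi_{V,\phi}=\prod_{x\in V}\Pi_{\phi(x)}(x)$ for $\phi\in\mathbb{Z}_k^V$; $\mathcal{A}(V,C)=\mathbb{C}\mathbb{Z}_k^V/\langle\Phi_{V,\phi}:\phi\notin C\rangle$. $\mathcal{A}_{c-c}(S)$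 is the free product of the $\mathcal{A}(V_i,C_i)$, $i\in[m]$. A weighted $*$-algebra $(\mathcal{A},\mu)$ is a $*$-algebra with a finitely supported weight function $\mu:\mathcal{A}\to[0,\infty)$. $\mathcal{A}_{c-c}(S,\pi)$ is $\mathcal{A}_{c-c}(S)$ with weight $\pi(i,j)$ on $\Phi_{V_i,\phi}\Phi_{V_j,\psi}$ for all $\phi\in C_i,\psi\in C_j$ with $\phi|_{V_i\cap V_j}\ne\psi|_{V_i\cap V_j}$, and $0$ elsewhere (weights of coinciding listed elements are added). $a\lesssim b$ means $b-a=\sum_jc_j^*c_j+\sum_l(f_lg_l-g_lf_l)$ for finitely many elements. A $C$-homomorphism $(\mathcal{A},\mu)\to(\mathcal{B},\nu)$ is a $*$-homomorphism $\alpha:\mathcal{A}\to\mathcal{B}$ with $\alpha(\sum_a\mu(a)a^*a)\lesssim C\sum_b\nu(b)b^*b$. *)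

theory Defs
  imports "HOL-Algebra.Algebraic_Closure_Type"
    "HOL-Probability.Probability_Mass_Function"
begin

section \<open>Unital complex *-algebras\<close>

abbreviation complex_ring :: "complex ring" where
  "complex_ring \<equiv> ring_of_type_algebra"

record 'a star_alg = "(complex, 'a) module" +
  adj :: "'a \<Rightarrow> 'a"

text \<open>The library locale \<^locale>\<open>algebra\<close> is restricted to commutative algebras, hence the
  extra bilinearity axioms here. The zero algebra is not excluded (it occurs as the algebra of an
  unsatisfiable constraint).\<close>

locale star_algebra = ring A + module complex_ring A
  for A :: "('a, 'm) star_alg_scheme" (structure) +
  assumes smult_mult_left:
      "\<lbrakk>x \<in> carrier A; y \<in> carrier A\<rbrakk> \<Longrightarrow> (c \<odot> x) \<otimes> y = c \<odot> (x \<otimes> y)"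
    and smult_mult_right:
      "\<lbrakk>x \<in> carrier A; y \<in> carrier A\<rbrakk> \<Longrightarrow> x \<otimes> (c \<odot> y) = c \<odot> (x \<otimes> y)"
    and adj_closed: "x \<in> carrier A \<Longrightarrow> adj A x \<in> carrier A"
    and adj_adj: "x \<in> carrier A \<Longrightarrow> adj A (adj A x) = x"
    and adj_add:
      "\<lbrakk>x \<in> carrier A; y \<in> carrier A\<rbrakk> \<Longrightarrow> adj A (x \<oplus> y) = adj A x \<oplus> adj A y"
    and adj_smult: "x \<in> carrier A \<Longrightarrow> adj A (c \<odot> x) = cnj c \<odot> adj A x"
    and adj_mult:
      "\<lbrakk>x \<in> carrier A; y \<in> carrier A\<rbrakk> \<Longrightarrow> adj A (x \<otimes> y) = adj A y \<otimes> adj A x"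

text \<open>\<^const>\<open>ring_hom\<close> already requires the unit to be preserved.\<close>

definition star_hom :: "('a, 'm) star_alg_scheme \<Rightarrow> ('b, 'n) star_alg_scheme \<Rightarrow> ('a \<Rightarrow> 'b) set" where
  "star_hom A B = {h \<in> ring_hom A B.
     (\<forall>c. \<forall>x\<in>carrier A. h (c \<odot>\<^bsub>A\<^esub> x) = c \<odot>\<^bsub>B\<^esub> h x) \<and>
     (\<forall>x\<in>carrier A. h (adj A x) = adj B (h x))}"

definition star_iso :: "('a, 'm) star_alg_scheme \<Rightarrow> ('b, 'n) star_alg_scheme \<Rightarrow> ('a \<Rightarrow> 'b) set" where
  "star_iso A B = {h \<in> star_hom A B. bij_betw h (carrier A) (carrier B)}"


subsection \<open>Quotients\<close>

definition star_idl :: "('a, 'm) star_alg_scheme \<Rightarrow> 'a set \<Rightarrow> 'a set" where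
  "star_idl A R = Idl\<^bsub>A\<^esub> (R \<union> adj A ` R)"

text \<open>The quotient by a two-sided ideal \<open>J\<close> closed under \<^const>\<open>adj\<close>; the ring structure is that
  of \<^const>\<open>FactRing\<close>. Scalar multiplication and adjoint are written on cosets in the same style
  as \<^const>\<open>rcoset_mult\<close>, so that they send \<open>J +> x\<close> to \<open>J +> c \<odot> x\<close> and to \<open>J +> adj A x\<close>.\<close>

definition star_quot :: "('a, 'm) star_alg_scheme \<Rightarrow> 'a set \<Rightarrow> 'a set star_alg" where
  "star_quot A J =
    \<lparr>carrier = carrier (A Quot J), monoid.mult = monoid.mult (A Quot J), one = \<one>\<^bsub>A Quot J\<^esub>,
     ring.zero = \<zero>\<^bsub>A Quot J\<^esub>, add = add (A Quot J),
     module.smult = (\<lambda>c Y. \<Union>x\<in>Y. J +>\<^bsub>A\<^esub> (c \<odot>\<^bsub>A\<^esub> x)),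
     adj = (\<lambda>Y. \<Union>x\<in>Y. J +>\<^bsub>A\<^esub> adj A x)\<rparr>"


subsection \<open>Free *-algebras and free products\<close>

text \<open>Elements of the free *-algebra on \<open>G\<close> are finitely supported complex functions on words in
  the letters \<open>(g, False)\<close>, standing for \<open>g\<close>, and \<open>(g, True)\<close>, standing for the adjoint of \<open>g\<close>.\<close>

type_synonym 'g free_elem = "('g \<times> bool) list \<Rightarrow> complex"

definition free_star_algebra :: "'g set \<Rightarrow> 'g free_elem star_alg" where
  "free_star_algebra G =
    \<lparr>carrier = {p. finite {w. p w \<noteq> 0} \<and> (\<forall>w. p w \<noteq> 0 \<longrightarrow> set w \<subseteq> G \<times> UNIV)},
     monoid.mult = (\<lambda>p q w. \<Sum>i\<le>length w. p (take i w) * q (drop i w)),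
     one = (\<lambda>w. if w = [] then 1 else 0),
     ring.zero = (\<lambda>w. 0),
     add = (\<lambda>p q w. p w + q w),
     module.smult = (\<lambda>c p w. c * p w),
     adj = (\<lambda>p w. cnj (p (rev (map (apsnd Not) w))))\<rparr>"

definition free_gen :: "'g \<Rightarrow> 'g free_elem" where
  "free_gen g = (\<lambda>w. if w = [(g, False)] then 1 else 0)"

text \<open>The free product of unital *-algebras (their coproduct): generated by the disjoint union of
  the carriers, subject to the relations saying that each \<open>a \<mapsto> (i, a)\<close> is a unital
  *-homomorphism.\<close>

definition free_product_ideal :: "'i set \<Rightarrow> ('i \<Rightarrow> 'a star_alg) \<Rightarrow> ('i \<times> 'a) free_elem set" where
  "free_product_ideal I A =
    (let F = free_star_algebra (SIGMA i:I. carrier (A i)); g = (\<lambda>i a. free_gen (i, a)) in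
     star_idl F
      ({(g i a \<oplus>\<^bsub>F\<^esub> g i b) \<ominus>\<^bsub>F\<^esub> g i (a \<oplus>\<^bsub>A i\<^esub> b) |i a b.
          i \<in> I \<and> a \<in> carrier (A i) \<and> b \<in> carrier (A i)} \<union>
       {(g i a \<otimes>\<^bsub>F\<^esub> g i b) \<ominus>\<^bsub>F\<^esub> g i (a \<otimes>\<^bsub>A i\<^esub> b) |i a b.
          i \<in> I \<and> a \<in> carrier (A i) \<and> b \<in> carrier (A i)} \<union>
       {(c \<odot>\<^bsub>F\<^esub> g i a) \<ominus>\<^bsub>F\<^esub> g i (c \<odot>\<^bsub>A i\<^esub> a) |i c a. i \<in> I \<and> a \<in> carrier (A i)} \<union>
       {adj F (g i a) \<ominus>\<^bsub>F\<^esub> g i (adj (A i) a) |i a. i \<in> I \<and> a \<in> carrier (A i)} \<union>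
       {g i \<one>\<^bsub>A i\<^esub> \<ominus>\<^bsub>F\<^esub> \<one>\<^bsub>F\<^esub> |i. i \<in> I}))"

definition free_product :: "'i set \<Rightarrow> ('i \<Rightarrow> 'a star_alg) \<Rightarrow> ('i \<times> 'a) free_elem set star_alg" where
  "free_product I A =
    star_quot (free_star_algebra (SIGMA i:I. carrier (A i))) (free_product_ideal I A)"

definition free_product_inj ::
    "'i set \<Rightarrow> ('i \<Rightarrow> 'a star_alg) \<Rightarrow> 'i \<Rightarrow> 'a \<Rightarrow> ('i \<times> 'a) free_elem set" where
  "free_product_inj I A i a =
    free_product_ideal I A +>\<^bsub>free_star_algebra (SIGMA i:I. carrier (A i))\<^esub> free_gen (i, a)"


section \<open>Weighted *-algebras\<close>

text \<open>Values of the weight function outside the carrier are irrelevant.\<close>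

locale weighted_star_algebra = star_algebra A
  for A :: "('a, 'm) star_alg_scheme" (structure) +
  fixes \<mu> :: "'a \<Rightarrow> real"
  assumes weight_nonneg: "a \<in> carrier A \<Longrightarrow> 0 \<le> \<mu> a"
    and weight_finite: "finite {a \<in> carrier A. \<mu> a \<noteq> 0}"

definition weight_sum :: "('a, 'm) star_alg_scheme \<Rightarrow> ('a \<Rightarrow> real) \<Rightarrow> 'a" where
  "weight_sum A \<mu> =
    (\<Oplus>\<^bsub>A\<^esub>a\<in>{a \<in> carrier A. \<mu> a \<noteq> 0}. complex_of_real (\<mu> a) \<odot>\<^bsub>A\<^esub> (adj A a \<otimes>\<^bsub>A\<^esub> a))"

definition lesssim :: "('a, 'm) star_alg_scheme \<Rightarrow> 'a \<Rightarrow> 'a \<Rightarrow> bool" where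
  "lesssim A a b \<longleftrightarrow>
    (\<exists>(p::nat) (q::nat) c f g.
       c \<in> {..<p} \<rightarrow> carrier A \<and> f \<in> {..<q} \<rightarrow> carrier A \<and> g \<in> {..<q} \<rightarrow> carrier A \<and>
       b \<ominus>\<^bsub>A\<^esub> a =
         (\<Oplus>\<^bsub>A\<^esub>j\<in>{..<p}. adj A (c j) \<otimes>\<^bsub>A\<^esub> c j) \<oplus>\<^bsub>A\<^esub>
         (\<Oplus>\<^bsub>A\<^esub>l\<in>{..<q}. (f l \<otimes>\<^bsub>A\<^esub> g l) \<ominus>\<^bsub>A\<^esub> (g l \<otimes>\<^bsub>A\<^esub> f l)))"

definition C_homomorphism ::
    "real \<Rightarrow> ('a, 'm) star_alg_scheme \<Rightarrow> ('a \<Rightarrow> real) \<Rightarrow>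
     ('b, 'n) star_alg_scheme \<Rightarrow> ('b \<Rightarrow> real) \<Rightarrow> ('a \<Rightarrow> 'b) \<Rightarrow> bool" where
  "C_homomorphism C A \<mu> B \<nu> \<alpha> \<longleftrightarrow>
     weighted_star_algebra A \<mu> \<and> weighted_star_algebra B \<nu> \<and> \<alpha> \<in> star_hom A B \<and>
     lesssim B (\<alpha> (weight_sum A \<mu>)) (complex_of_real C \<odot>\<^bsub>B\<^esub> weight_sum B \<nu>)"


section \<open>Constraint systems\<close>

text \<open>Assignments in \<open>\<int>\<^sub>k\<^sup>V\<close> are the extensional functions \<open>V \<rightarrow>\<^sub>E {..<k}\<close>.
  The constraints are indexed by list positions \<open>0, \<dots>, m - 1\<close>.\<close>

record 'x csys =
  variables :: "'x set"
  constraints :: "('x set \<times> ('x \<Rightarrow> nat) set) list"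

abbreviation num_constraints :: "'x csys \<Rightarrow> nat" where
  "num_constraints S \<equiv> length (constraints S)"

abbreviation scope :: "'x csys \<Rightarrow> nat \<Rightarrow> 'x set" where
  "scope S i \<equiv> fst (constraints S ! i)"

abbreviation allowed :: "'x csys \<Rightarrow> nat \<Rightarrow> ('x \<Rightarrow> nat) set" where
  "allowed S i \<equiv> snd (constraints S ! i)"

definition constraint_system :: "nat \<Rightarrow> 'x csys \<Rightarrow> bool" where
  "constraint_system k S \<longleftrightarrow> finite (variables S) \<and>
     (\<forall>(V, C) \<in> set (constraints S). V \<subseteq> variables S \<and> C \<subseteq> (V \<rightarrow>\<^sub>E {..<k}))"

definition bool_assignment :: "nat \<Rightarrow> 'x set \<Rightarrow> ('x \<Rightarrow> nat) \<Rightarrow> ('x \<times> nat \<Rightarrow> nat)" where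
  "bool_assignment k V \<phi> = (\<lambda>(x, a)\<in>V \<times> {..<k}. if \<phi> x = a then 1 else 0)"

definition boolean_form :: "nat \<Rightarrow> 'x csys \<Rightarrow> ('x \<times> nat) csys" where
  "boolean_form k S =
    \<lparr>variables = variables S \<times> {..<k},
     constraints = map (\<lambda>(V, C). (V \<times> {..<k}, bool_assignment k V ` C)) (constraints S)\<rparr>"

lemma bool_assignment_in_PiE: "bool_assignment k V \<phi> \<in> (V \<times> {..<k}) \<rightarrow>\<^sub>E {..<2}"
  by (rule PiE_I) (auto simp: bool_assignment_def)

lemma constraint_system_boolean_form:
  assumes "constraint_system k S"
  shows "constraint_system 2 (boolean_form k S)"
proof -
  have "finite (variables (boolean_form k S))"
    using assms by (simp add: constraint_system_def boolean_form_def)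
  moreover have "V' \<subseteq> variables (boolean_form k S) \<and> C' \<subseteq> (V' \<rightarrow>\<^sub>E {..<2})"
    if mem: "(V', C') \<in> set (constraints (boolean_form k S))" for V' C'
  proof -
    obtain V C where VC: "(V, C) \<in> set (constraints S)"
      and eqs: "V' = V \<times> {..<k}" "C' = bool_assignment k V ` C"
      using mem by (auto simp: boolean_form_def)
    have "V \<subseteq> variables S"
      using assms VC unfolding constraint_system_def by blast
    then have "V' \<subseteq> variables (boolean_form k S)"
      unfolding eqs boolean_form_def by auto
    moreover have "C' \<subseteq> (V' \<rightarrow>\<^sub>E {..<2})"
      unfolding eqs using bool_assignment_in_PiE by (rule image_subsetI)
    ultimately show ?thesis ..
  qed
  ultimately show ?thesis
    unfolding constraint_system_def by blast
qed


section \<open>Constraint algebras\<close>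

type_synonym 'x cyc_elem = "'x free_elem set"
type_synonym 'x constraint_elem = "'x cyc_elem set"
type_synonym 'x cc_elem = "(nat \<times> 'x constraint_elem) free_elem set"

definition cyc_ideal :: "nat \<Rightarrow> 'x set \<Rightarrow> 'x free_elem set" where
  "cyc_ideal k V =
    (let F = free_star_algebra V; g = free_gen in
     star_idl F
      ({(g x \<otimes>\<^bsub>F\<^esub> g y) \<ominus>\<^bsub>F\<^esub> (g y \<otimes>\<^bsub>F\<^esub> g x) |x y. x \<in> V \<and> y \<in> V} \<union>
       {(adj F (g x) \<otimes>\<^bsub>F\<^esub> g x) \<ominus>\<^bsub>F\<^esub> \<one>\<^bsub>F\<^esub> |x. x \<in> V} \<union>
       {(g x \<otimes>\<^bsub>F\<^esub> adj F (g x)) \<ominus>\<^bsub>F\<^esub> \<one>\<^bsub>F\<^esub> |x. x \<in> V} \<union>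
       {(g x [^]\<^bsub>F\<^esub> k) \<ominus>\<^bsub>F\<^esub> \<one>\<^bsub>F\<^esub> |x. x \<in> V}))"

text \<open>The algebra \<open>\<complex>\<int>\<^sub>k\<^sup>V\<close>.\<close>

definition cyc_algebra :: "nat \<Rightarrow> 'x set \<Rightarrow> 'x cyc_elem star_alg" where
  "cyc_algebra k V = star_quot (free_star_algebra V) (cyc_ideal k V)"

definition cyc_gen :: "nat \<Rightarrow> 'x set \<Rightarrow> 'x \<Rightarrow> 'x cyc_elem" where
  "cyc_gen k V x = cyc_ideal k V +>\<^bsub>free_star_algebra V\<^esub> free_gen x"

definition root_unity :: "nat \<Rightarrow> complex" where
  "root_unity k = exp (2 * of_real pi * \<i> / of_nat k)"

definition spectral_proj :: "nat \<Rightarrow> 'x set \<Rightarrow> nat \<Rightarrow> 'x \<Rightarrow> 'x cyc_elem" where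
  "spectral_proj k V a x =
    (1 / of_nat k) \<odot>\<^bsub>cyc_algebra k V\<^esub>
      (\<Oplus>\<^bsub>cyc_algebra k V\<^esub>n\<in>{..<k}.
         (root_unity k powi (- (int n * int a))) \<odot>\<^bsub>cyc_algebra k V\<^esub>
           (cyc_gen k V x [^]\<^bsub>cyc_algebra k V\<^esub> n))"

definition Phi :: "nat \<Rightarrow> 'x set \<Rightarrow> ('x \<Rightarrow> nat) \<Rightarrow> 'x cyc_elem" where
  "Phi k V \<phi> = (\<Otimes>\<^bsub>cyc_algebra k V\<^esub>x\<in>V. spectral_proj k V (\<phi> x) x)"

definition constraint_ideal :: "nat \<Rightarrow> 'x set \<Rightarrow> ('x \<Rightarrow> nat) set \<Rightarrow> 'x cyc_elem set" where
  "constraint_ideal k V C =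
    star_idl (cyc_algebra k V) {Phi k V \<phi> |\<phi>. \<phi> \<in> (V \<rightarrow>\<^sub>E {..<k}) \<and> \<phi> \<notin> C}"

definition constraint_algebra ::
    "nat \<Rightarrow> 'x set \<Rightarrow> ('x \<Rightarrow> nat) set \<Rightarrow> 'x constraint_elem star_alg" where
  "constraint_algebra k V C = star_quot (cyc_algebra k V) (constraint_ideal k V C)"

definition cc_algebra :: "nat \<Rightarrow> 'x csys \<Rightarrow> 'x cc_elem star_alg" where
  "cc_algebra k S =
    free_product {..<num_constraints S} (\<lambda>i. constraint_algebra k (scope S i) (allowed S i))"

text \<open>The image of \<open>\<Phi>\<^bsub>V\<^sub>i, \<phi>\<^esub>\<close> in the free product.\<close>

definition cc_Phi :: "nat \<Rightarrow> 'x csys \<Rightarrow> nat \<Rightarrow> ('x \<Rightarrow> nat) \<Rightarrow> 'x cc_elem" where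
  "cc_Phi k S i \<phi> =
    free_product_inj {..<num_constraints S}
      (\<lambda>i. constraint_algebra k (scope S i) (allowed S i)) i
      (constraint_ideal k (scope S i) (allowed S i)
        +>\<^bsub>cyc_algebra k (scope S i)\<^esub> Phi k (scope S i) \<phi>)"

definition conflicts :: "'x csys \<Rightarrow> (nat \<times> nat \<times> ('x \<Rightarrow> nat) \<times> ('x \<Rightarrow> nat)) set" where
  "conflicts S =
    {(i, j, \<phi>, \<psi>). i < num_constraints S \<and> j < num_constraints S \<and>
       \<phi> \<in> allowed S i \<and> \<psi> \<in> allowed S j \<and>
       restrict \<phi> (scope S i \<inter> scope S j) \<noteq> restrict \<psi> (scope S i \<inter> scope S j)}"

text \<open>Distinct conflicts may give the same algebra element (for instance \<open>0\<close> if \<open>i = j\<close>);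
  their weights are added.\<close>

definition cc_weight :: "nat \<Rightarrow> 'x csys \<Rightarrow> (nat \<times> nat) pmf \<Rightarrow> 'x cc_elem \<Rightarrow> real" where
  "cc_weight k S \<pi> a =
    (\<Sum>(i, j, \<phi>, \<psi>) \<in> {(i, j, \<phi>, \<psi>) \<in> conflicts S.
         cc_Phi k S i \<phi> \<otimes>\<^bsub>cc_algebra k S\<^esub> cc_Phi k S j \<psi> = a}. pmf \<pi> (i, j))"

end

theory Submission
  imports Defs
begin

text \<open>Each \<open>\<A>(V, C)\<close> is the algebra of functions on the finite set \<open>C\<close>: the evaluations at
  \<open>\<phi> \<in> C\<close> are characters, \<open>p \<Phi>\<^sub>\<phi> = p(\<phi>) \<Phi>\<^sub>\<phi>\<close> for every \<open>p\<close>, and the \<open>\<Phi>\<^sub>\<phi>\<close> sum to \<open>1\<close>, so an element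
  is determined by its values on \<open>C\<close> and the values can be prescribed. Hence the bijection
  \<open>\<phi>' \<mapsto> \<phi>\<close> from \<open>C'\<^sub>i\<close> to \<open>C\<^sub>i\<close> gives isomorphisms \<open>\<A>(V'\<^sub>i, C'\<^sub>i) \<rightarrow> \<A>(V\<^sub>i, C\<^sub>i)\<close> that send \<open>\<Phi>\<^bsub>\<phi>'\<^esub>\<close> to \<open>\<Phi>\<^sub>\<phi>\<close>,
  and together they give an isomorphism \<open>\<alpha>\<close> of the free products. Since \<open>\<phi>'\<close> and \<open>\<psi>'\<close> conflict iff \<open>\<phi>\<close> and \<open>\<psi>\<close> do,
  \<open>\<alpha>\<close> carries one weight function to the other, and the sums compared by \<open>\<lesssim>\<close> are equal.\<close>

section \<open>The free *-algebra\<close>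

text \<open>The obstacle is that every algebra here is a quotient presented by relations, in which
  equalities are hard to recognise. Inside one constraint the remedy is to compare values at points.
  The isomorphism of constraint algebras is therefore prescribed by values instead of on generators,
  where it would read (x, a) \<mapsto> 1 - 2 Pi_a(x), and no relation has to be verified for that
  map. One description serves both sides, with k and with 2: assignments of the boolean variables
  that do not come from an allowed \<phi> are killed by the constraint ideal. Across constraints
  there is in general no description by values. There the presentation itself helps: the generators
  of the free product are all elements of the components, and its relations mention only the
  operations of the components, so componentwise isomorphisms merely rename letters.\<close>

lemma complex_ring_simps [simp]:
  "carrier complex_ring = UNIV" "x \<otimes>\<^bsub>complex_ring\<^esub> y = x * y" "x \<oplus>\<^bsub>complex_ring\<^esub> y = x + y"
  "\<one>\<^bsub>complex_ring\<^esub> = 1" "\<zero>\<^bsub>complex_ring\<^esub> = 0"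
  by (simp_all add: ring_of_type_algebra_def)

text \<open>In \<^locale>\<open>star_algebra\<close> the unqualified ring facts are those of \<^const>\<open>complex_ring\<close>;
  this equivalent locale makes them facts about the algebra.\<close>

locale plain_star_algebra = ring A for A :: "('a, 'm) star_alg_scheme" (structure) +
  assumes smult_closed [simp, intro]: "x \<in> carrier A \<Longrightarrow> c \<odot> x \<in> carrier A"
    and smult_l_distr: "x \<in> carrier A \<Longrightarrow> (c + d) \<odot> x = c \<odot> x \<oplus> d \<odot> x"
    and smult_r_distr: "\<lbrakk>x \<in> carrier A; y \<in> carrier A\<rbrakk> \<Longrightarrow> c \<odot> (x \<oplus> y) = c \<odot> x \<oplus> c \<odot> y"
    and smult_smult: "x \<in> carrier A \<Longrightarrow> c \<odot> (d \<odot> x) = (c * d) \<odot> x"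
    and smult_one [simp]: "x \<in> carrier A \<Longrightarrow> 1 \<odot> x = x"
    and smult_mult_left: "\<lbrakk>x \<in> carrier A; y \<in> carrier A\<rbrakk> \<Longrightarrow> (c \<odot> x) \<otimes> y = c \<odot> (x \<otimes> y)"
    and smult_mult_right: "\<lbrakk>x \<in> carrier A; y \<in> carrier A\<rbrakk> \<Longrightarrow> x \<otimes> (c \<odot> y) = c \<odot> (x \<otimes> y)"
    and adj_closed [simp, intro]: "x \<in> carrier A \<Longrightarrow> adj A x \<in> carrier A"
    and adj_adj [simp]: "x \<in> carrier A \<Longrightarrow> adj A (adj A x) = x"
    and adj_add: "\<lbrakk>x \<in> carrier A; y \<in> carrier A\<rbrakk> \<Longrightarrow> adj A (x \<oplus> y) = adj A x \<oplus> adj A y"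
    and adj_smult: "x \<in> carrier A \<Longrightarrow> adj A (c \<odot> x) = cnj c \<odot> adj A x"
    and adj_mult: "\<lbrakk>x \<in> carrier A; y \<in> carrier A\<rbrakk> \<Longrightarrow> adj A (x \<otimes> y) = adj A y \<otimes> adj A x"

lemma star_algebra_plain: "plain_star_algebra A \<Longrightarrow> star_algebra A"
proof -
  assume "plain_star_algebra A"
  then interpret plain_star_algebra A .
  have "module complex_ring A"
    by (rule moduleI)
      (auto simp: smult_l_distr smult_r_distr smult_smult
        intro: cring_from_type_algebra abelian_group_axioms)
  then show "star_algebra A"
    using ring_axioms smult_mult_left smult_mult_right adj_add adj_smult adj_mult
    by (simp add: star_algebra_def star_algebra_axioms_def)
qed

context plain_star_algebra
begin

lemma smult_0_left [simp]: "x \<in> carrier A \<Longrightarrow> 0 \<odot> x = \<zero>"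
  using smult_l_distr[of x 0 0] add.l_cancel_one' by fastforce

lemma smult_0_right [simp]: "c \<odot> \<zero> = \<zero>"
  using smult_r_distr[of \<zero> \<zero> c] by (metis add.l_cancel_one' r_zero smult_closed zero_closed)

lemma smult_minus_one: "x \<in> carrier A \<Longrightarrow> (- 1) \<odot> x = \<ominus> x"
  using smult_l_distr[of x "-1" 1] by (simp add: minus_equality)

lemma minus_eq_smult: "\<lbrakk>x \<in> carrier A; y \<in> carrier A\<rbrakk> \<Longrightarrow> x \<ominus> y = x \<oplus> (- 1) \<odot> y"
  by (simp add: smult_minus_one minus_eq)

lemma adj_zero [simp]: "adj A \<zero> = \<zero>"
  using adj_smult[of \<zero> 0] by simp

lemma adj_one [simp]: "adj A \<one> = \<one>"
  using adj_mult[of "adj A \<one>" \<one>] by simp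

text \<open>Scaling is multiplication by a multiple of the unit; this makes ideals complex subspaces
  (\<open>smult_mem\<close>).\<close>

lemma smult_eq_mult: "x \<in> carrier A \<Longrightarrow> c \<odot> x = (c \<odot> \<one>) \<otimes> x"
  by (simp add: smult_mult_left)

end

section \<open>Words, convolution and adjoints of words\<close>

abbreviation flip_word :: "('g \<times> bool) list \<Rightarrow> ('g \<times> bool) list" where
  "flip_word w \<equiv> rev (map (apsnd Not) w)"

lemma flip_word_flip_word [simp]: "flip_word (flip_word w) = w"
  by (simp add: rev_map comp_def apsnd_compose[unfolded comp_def] apsnd_def map_prod_def split_beta)

text \<open>The product of the free algebra, over an arbitrary letter type and without support
  conditions, so that inductions may freely replace \<open>p\<close> by its shift
  \<open>\<lambda>u. p (a # u)\<close>.\<close>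

definition conv :: "('l list \<Rightarrow> complex) \<Rightarrow> ('l list \<Rightarrow> complex) \<Rightarrow> 'l list \<Rightarrow> complex" where
  "conv p q w = (\<Sum>i\<le>length w. p (take i w) * q (drop i w))"

lemma conv_Nil [simp]: "conv p q [] = p [] * q []"
  by (simp add: conv_def)

text \<open>A cut of \<open>a # w\<close> either precedes \<open>a\<close> or is a cut of
  \<open>w\<close> with \<open>a\<close> put in front of the left piece.\<close>

lemma conv_Cons: "conv p q (a # w) = p [] * q (a # w) + conv (\<lambda>u. p (a # u)) q w"
  by (simp add: conv_def sum.atMost_Suc_shift del: sum.atMost_Suc)

lemma conv_add_left: "conv (\<lambda>w. p w + p' w) q w = conv p q w + conv p' q w"
  by (simp add: conv_def sum.distrib algebra_simps)

lemma conv_add_right: "conv p (\<lambda>w. q w + q' w) w = conv p q w + conv p q' w"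
  by (simp add: conv_def sum.distrib algebra_simps)

lemma conv_scale_left: "conv (\<lambda>w. c * p w) q w = c * conv p q w"
  by (simp add: conv_def sum_distrib_left algebra_simps)

lemma conv_scale_right: "conv p (\<lambda>w. c * q w) w = c * conv p q w"
  by (simp add: conv_def sum_distrib_left algebra_simps)

text \<open>Shifting \<open>conv p q\<close> by a letter gives a multiple of the shift of
  \<open>q\<close> plus the convolution of the shift of \<open>p\<close> with \<open>q\<close>.
  Linearity in the left argument reduces the claim to the shift of \<open>p\<close>, hence the
  generalisation over \<open>p\<close>.\<close>

lemma conv_assoc: "conv (conv p q) r w = conv p (conv q r) w"
proof (induction w arbitrary: p)
  case (Cons a w)
  have "conv (conv p q) r (a # w) =
      p [] * q [] * r (a # w) + conv (\<lambda>u. p [] * q (a # u) + conv (\<lambda>v. p (a # v)) q u) r w"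
    by (simp add: conv_Cons)
  also have "\<dots> = p [] * conv q r (a # w) + conv (\<lambda>v. p (a # v)) (conv q r) w"
    by (simp add: conv_add_left conv_scale_left Cons.IH conv_Cons algebra_simps)
  finally show ?case by (simp add: conv_Cons)
qed simp

lemma conv_unit_left: "conv (\<lambda>w. if w = [] then 1 else 0) q w = q w"
  by (cases w) (simp_all add: conv_Cons, simp add: conv_def)

lemma conv_unit_right: "conv p (\<lambda>w. if w = [] then 1 else 0) w = p w"
  by (induction w arbitrary: p) (simp_all add: conv_Cons)

text \<open>Reversal turns a cut after \<open>i\<close> letters into one after
  \<open>length w - i\<close> letters and exchanges the two pieces; hence the swapped
  factors.\<close>

lemma conv_flip: "cnj (conv p q (flip_word w)) =
    conv (\<lambda>u. cnj (q (flip_word u))) (\<lambda>u. cnj (p (flip_word u))) w"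
  unfolding conv_def cnj_sum
  by (rule sum.reindex_bij_witness[of _ "\<lambda>i. length w - i" "\<lambda>i. length w - i"])
     (auto simp: take_rev drop_rev take_map drop_map rev_map)

text \<open>Cuts of \<open>w\<close> correspond to pairs with \<open>u @ v = w\<close>. In this form
  the sum can later be regrouped along concatenation, which makes evaluation multiplicative.\<close>

lemma conv_eq_sum:
  assumes "finite P" "finite Q" "{u. p u \<noteq> 0} \<subseteq> P" "{v. q v \<noteq> 0} \<subseteq> Q"
  shows "conv p q w = (\<Sum>(u, v) \<in> {(u, v) \<in> P \<times> Q. u @ v = w}. p u * q v)"
proof -
  have "conv p q w = (\<Sum>(u, v) \<in> {(u, v). u @ v = w}. p u * q v)"
    unfolding conv_def
    by (rule sum.reindex_bij_witness[of _ "\<lambda>(u, v). length u" "\<lambda>i. (take i w, drop i w)"]) auto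
  also have "\<dots> = (\<Sum>(u, v) \<in> {(u, v) \<in> P \<times> Q. u @ v = w}. p u * q v)"
  proof (rule sum.mono_neutral_right)
    have "{(u, v). u @ v = w} \<subseteq> (\<lambda>i. (take i w, drop i w)) ` {..length w}"
    proof clarify
      fix u v :: "'l list"
      show "(u, v) \<in> (\<lambda>i. (take i (u @ v), drop i (u @ v))) ` {..length (u @ v)}"
        by (rule image_eqI[of _ _ "length u"]) auto
    qed
    then show "finite {(u, v). u @ v = w}" by (rule finite_subset) simp
  qed (use assms in auto)
  finally show ?thesis .
qed

lemma conv_support:
  assumes "conv p q w \<noteq> 0"
  obtains u v where "w = u @ v" "p u \<noteq> 0" "q v \<noteq> 0"
proof -
  obtain i where "p (take i w) * q (drop i w) \<noteq> 0"
    using assms unfolding conv_def by (meson sum.neutral)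
  then show ?thesis using that[of "take i w" "drop i w"] by simp
qed

lemma free_star_algebra_simps [simp]:
  "monoid.mult (free_star_algebra G) = conv"
  "\<one>\<^bsub>free_star_algebra G\<^esub> = (\<lambda>w. if w = [] then 1 else 0)"
  "\<zero>\<^bsub>free_star_algebra G\<^esub> = (\<lambda>w. 0)"
  "p \<oplus>\<^bsub>free_star_algebra G\<^esub> q = (\<lambda>w. p w + q w)"
  "c \<odot>\<^bsub>free_star_algebra G\<^esub> p = (\<lambda>w. c * p w)"
  "adj (free_star_algebra G) p = (\<lambda>w. cnj (p (flip_word w)))"
  by (simp_all add: free_star_algebra_def conv_def fun_eq_iff)

lemma free_star_algebra_carrier_iff:
  "p \<in> carrier (free_star_algebra G) \<longleftrightarrow>
     finite {w. p w \<noteq> 0} \<and> (\<forall>w. p w \<noteq> 0 \<longrightarrow> set w \<subseteq> G \<times> UNIV)"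
  by (simp add: free_star_algebra_def)

lemma conv_closed:
  assumes "p \<in> carrier (free_star_algebra G)" "q \<in> carrier (free_star_algebra G)"
  shows "conv p q \<in> carrier (free_star_algebra G)"
proof -
  have "{w. conv p q w \<noteq> 0} \<subseteq> (\<lambda>(u, v). u @ v) ` ({u. p u \<noteq> 0} \<times> {v. q v \<noteq> 0})"
    by (auto elim!: conv_support)
  then have "finite {w. conv p q w \<noteq> 0}"
    by (rule finite_subset) (use assms in \<open>auto simp: free_star_algebra_carrier_iff\<close>)
  then show ?thesis
    using assms by (fastforce simp: free_star_algebra_carrier_iff elim!: conv_support)
qed

lemma free_add_closed:
  assumes "p \<in> carrier (free_star_algebra G)" "q \<in> carrier (free_star_algebra G)"
  shows "(\<lambda>w. p w + q w) \<in> carrier (free_star_algebra G)"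
proof -
  have "finite {w. p w + q w \<noteq> 0}"
    by (rule finite_subset[of _ "{w. p w \<noteq> 0} \<union> {w. q w \<noteq> 0}"])
      (use assms in \<open>auto simp: free_star_algebra_carrier_iff\<close>)
  moreover have "p w \<noteq> 0 \<or> q w \<noteq> 0" if "p w + q w \<noteq> 0" for w
    using that by auto
  ultimately show ?thesis
    using assms unfolding free_star_algebra_carrier_iff by blast
qed

lemma free_scale_closed:
  assumes "p \<in> carrier (free_star_algebra G)"
  shows "(\<lambda>w. c * p w) \<in> carrier (free_star_algebra G)"
  using assms by (auto simp: free_star_algebra_carrier_iff)

lemma free_adj_closed:
  assumes "p \<in> carrier (free_star_algebra G)"
  shows "(\<lambda>w. cnj (p (flip_word w))) \<in> carrier (free_star_algebra G)"
proof -
  have "{w. p (flip_word w) \<noteq> 0} = flip_word ` {w. p w \<noteq> 0}"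
    by (auto simp: image_iff) (metis flip_word_flip_word)
  then have "finite {w. p (flip_word w) \<noteq> 0}"
    using assms by (simp add: free_star_algebra_carrier_iff)
  moreover have "set w \<subseteq> G \<times> UNIV" if "p (flip_word w) \<noteq> 0" for w
  proof -
    have "set (flip_word w) \<subseteq> G \<times> UNIV"
      using assms that unfolding free_star_algebra_carrier_iff by blast
    then show ?thesis by (fastforce simp: apsnd_def map_prod_def)
  qed
  ultimately show ?thesis
    by (simp add: free_star_algebra_carrier_iff)
qed

lemma plain_star_algebra_free: "plain_star_algebra (free_star_algebra G)"
proof -
  let ?F = "free_star_algebra G"
  have "abelian_group ?F"
  proof (rule abelian_groupI)
    fix p assume "p \<in> carrier ?F"
    then have "(\<lambda>w. - 1 * p w) \<in> carrier ?F" by (rule free_scale_closed)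
    then show "\<exists>q\<in>carrier ?F. q \<oplus>\<^bsub>?F\<^esub> p = \<zero>\<^bsub>?F\<^esub>" by (rule rev_bexI) auto
  qed (auto simp: free_add_closed add_ac, simp add: free_star_algebra_carrier_iff)
  moreover have "monoid ?F"
    by (rule monoidI)
      (auto simp: conv_closed conv_assoc conv_unit_left conv_unit_right,
        auto simp: free_star_algebra_carrier_iff)
  ultimately have "ring ?F"
    by (rule ringI) (auto simp: conv_add_left conv_add_right)
  then show ?thesis
    unfolding plain_star_algebra_def plain_star_algebra_axioms_def
    by (auto simp: free_scale_closed free_adj_closed conv_scale_left conv_scale_right conv_flip
        algebra_simps)
qed

lemma free_gen_closed [simp]: "g \<in> G \<Longrightarrow> free_gen g \<in> carrier (free_star_algebra G)"
  by (simp add: free_gen_def free_star_algebra_carrier_iff)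

lemma adj_free_gen:
  "(\<lambda>w. cnj (free_gen g (flip_word w))) = (\<lambda>w. if w = [(g, True)] then 1 else 0)"
proof -
  have "flip_word w = [(g, False)] \<longleftrightarrow> w = [(g, True)]" for w
    by (auto simp: rev_eq_Cons_iff map_eq_Cons_conv apsnd_def map_prod_def)
  then show ?thesis by (simp add: free_gen_def fun_eq_iff)
qed

lemma conv_letter:
  "conv (\<lambda>w. if w = [l] then 1 else 0) (\<lambda>w. if w = u then 1 else 0) =
     (\<lambda>w. if w = l # u then 1 else 0)"
proof
  fix w
  show "conv (\<lambda>w. if w = [l] then 1 else 0) (\<lambda>w. if w = u then 1 else 0) w =
     (if w = l # u then 1 else 0)"
  proof (cases w)
    case (Cons a v)
    have "conv (\<lambda>w. 0) q v = 0" for q by (simp add: conv_def)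
    then show ?thesis
      using conv_unit_left[of "\<lambda>w. if w = u then 1 else 0" v] by (cases "a = l") (simp_all add: Cons conv_Cons)
  qed simp
qed

section \<open>Star subalgebras and generation\<close>

definition star_subalgebra :: "('a, 'm) star_alg_scheme \<Rightarrow> 'a set \<Rightarrow> bool" where
  "star_subalgebra A T \<longleftrightarrow> T \<subseteq> carrier A \<and> \<one>\<^bsub>A\<^esub> \<in> T \<and>
     (\<forall>x\<in>T. \<forall>y\<in>T. x \<oplus>\<^bsub>A\<^esub> y \<in> T \<and> x \<otimes>\<^bsub>A\<^esub> y \<in> T) \<and>
     (\<forall>x\<in>T. adj A x \<in> T \<and> (\<forall>c. c \<odot>\<^bsub>A\<^esub> x \<in> T))"

text \<open>The induction principle for the free algebra: letters are generators and their adjoints,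
  words are products of letters (\<open>conv_letter\<close>), and every element is a finite
  combination of words. Zero and negatives lie in \<open>T\<close> through the scalars 0 and
  -1.\<close>

lemma free_star_algebra_generated:
  assumes T: "star_subalgebra (free_star_algebra G) T" and gens: "free_gen ` G \<subseteq> T"
  shows "T = carrier (free_star_algebra G)"
proof
  have word: "(\<lambda>w. if w = u then 1 else 0) \<in> T" if "set u \<subseteq> G \<times> UNIV" for u
    using that
  proof (induction u)
    case Nil
    then show ?case using T by (simp add: star_subalgebra_def)
  next
    case (Cons l u)
    obtain g b where l: "l = (g, b)" by (cases l)
    have "g \<in> G" using Cons.prems l by auto
    then have "free_gen g \<in> T" "(\<lambda>w. cnj (free_gen g (flip_word w))) \<in> T"
      using gens T by (auto simp: star_subalgebra_def)
    then have "(\<lambda>w. if w = [l] then 1 else 0) \<in> T"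
      unfolding adj_free_gen unfolding free_gen_def l by (cases b) auto
    moreover have "(\<lambda>w. if w = u then 1 else 0) \<in> T"
      using Cons by simp
    ultimately have "conv (\<lambda>w. if w = [l] then 1 else 0) (\<lambda>w. if w = u then 1 else 0) \<in> T"
      using T by (simp add: star_subalgebra_def)
    then show ?case by (simp add: conv_letter)
  qed
  have scaled: "(\<lambda>w. c * p w) \<in> T" if "p \<in> T" for c p
    using T that by (simp add: star_subalgebra_def)
  \<comment> \<open>The induction runs over a finite set containing the support; a new word either
    has coefficient 0 or is split off by resetting its coefficient to 0.\<close>
  have "p \<in> T" if "finite W" "{w. p w \<noteq> 0} \<subseteq> W" "\<forall>w. p w \<noteq> 0 \<longrightarrow> set w \<subseteq> G \<times> UNIV" for W p
    using that
  proof (induction W arbitrary: p)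
    case empty
    then have "p = (\<lambda>w. 0 * (if w = [] then 1 else 0))" by auto
    then show ?case using scaled[OF word[of "[]"], of 0] by simp
  next
    case (insert u W)
    show ?case
    proof (cases "p u = 0")
      case True
      then have "{w. p w \<noteq> 0} \<subseteq> W" using insert.prems by auto
      then show ?thesis using insert by blast
    next
      case False
      have "p(u := 0) \<in> T" by (rule insert.IH) (use insert.prems in auto)
      moreover have "(\<lambda>w. p u * (if w = u then 1 else 0)) \<in> T"
        using False insert.prems by (intro scaled word) auto
      ultimately have "(\<lambda>w. (p(u := 0)) w + p u * (if w = u then 1 else 0)) \<in> T"
        using T[unfolded star_subalgebra_def free_star_algebra_simps] by meson
      moreover have "(\<lambda>w. (p(u := 0)) w + p u * (if w = u then 1 else 0)) = p" by auto
      ultimately show ?thesis by simp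
    qed
  qed
  then show "carrier (free_star_algebra G) \<subseteq> T"
    by (auto simp: free_star_algebra_carrier_iff)
  show "T \<subseteq> carrier (free_star_algebra G)"
    using T by (simp add: star_subalgebra_def)
qed

declare free_star_algebra_simps [simp del]

section \<open>Quotients, characters and isomorphisms\<close>

text \<open>Absorption supplies additive inverses, since \<open>\<ominus> x\<close> is the product
  of \<open>\<ominus> \<one>\<close> and \<open>x\<close>. The ideals to be recognised below are
  kernels and preimages, for which these conditions are immediate.\<close>

lemma (in ring) idealI_mult:
  assumes "J \<subseteq> carrier R" "\<zero> \<in> J"
    and "\<And>x y. \<lbrakk>x \<in> J; y \<in> J\<rbrakk> \<Longrightarrow> x \<oplus> y \<in> J"
    and "\<And>x y. \<lbrakk>x \<in> J; y \<in> carrier R\<rbrakk> \<Longrightarrow> y \<otimes> x \<in> J"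
    and "\<And>x y. \<lbrakk>x \<in> J; y \<in> carrier R\<rbrakk> \<Longrightarrow> x \<otimes> y \<in> J"
  shows "ideal J R"
proof (rule idealI)
  show "subgroup J (add_monoid R)"
  proof (rule add.subgroupI)
    fix x assume "x \<in> J"
    then have "\<ominus> x = (\<ominus> \<one>) \<otimes> x" using assms(1) by (auto simp: l_minus)
    then show "\<ominus> x \<in> J" using \<open>x \<in> J\<close> assms(4) by simp
  qed (use assms in auto)
qed (use assms ring_axioms in auto)

locale star_ideal = plain_star_algebra A + ideal J A
  for J and A :: "('a, 'm) star_alg_scheme" (structure) +
  assumes adj_mem: "x \<in> J \<Longrightarrow> adj A x \<in> J"
begin

abbreviation Q :: "'a set star_alg" where "Q \<equiv> star_quot A J"

lemma coset_eq_iff: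
  assumes "x \<in> carrier A" "y \<in> carrier A"
  shows "J +> x = J +> y \<longleftrightarrow> x \<ominus> y \<in> J"
  using quotient_eq_iff_same_a_r_cos[OF is_ideal assms] by blast

lemma smult_mem:
  assumes "x \<in> J" shows "c \<odot> x \<in> J"
  using assms smult_eq_mult[of x c] I_l_closed[of x "c \<odot> \<one>"] by simp

text \<open>Well-definedness of scalar multiplication and adjoint on cosets: a representative
  \<open>j \<oplus> x\<close> gives \<open>f j \<oplus> f x\<close>, which differs from
  \<open>f x\<close> by an element of \<open>J\<close>. So the union is over copies of a single
  coset.\<close>

lemma Union_coset:
  assumes closed: "\<And>x. x \<in> carrier A \<Longrightarrow> f x \<in> carrier A"
    and add: "\<And>x y. \<lbrakk>x \<in> carrier A; y \<in> carrier A\<rbrakk> \<Longrightarrow> f (x \<oplus> y) = f x \<oplus> f y"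
    and mem: "\<And>x. x \<in> J \<Longrightarrow> f x \<in> J"
    and x: "x \<in> carrier A"
  shows "(\<Union>y\<in>J +> x. J +> f y) = J +> f x"
proof -
  have "J +> f y = J +> f x" if "y \<in> J +> x" for y
  proof -
    obtain j where j: "j \<in> J" "y = j \<oplus> x"
      using \<open>y \<in> J +> x\<close> by (auto simp: a_r_coset_def')
    then have "f y = f j \<oplus> f x" using add x by simp
    moreover have "f j \<oplus> f x \<ominus> f x = f j"
      using j x closed by (simp add: minus_eq a_assoc r_neg)
    ultimately show ?thesis
      using coset_eq_iff[of "f y" "f x"] mem j x closed by simp
  qed
  moreover have "x \<in> J +> x" using x a_rcos_self by blast
  ultimately show ?thesis by blast
qed

lemma quot_simps:
  "carrier Q = (+>) J ` carrier A"
  "\<one>\<^bsub>Q\<^esub> = J +> \<one>"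
  "\<zero>\<^bsub>Q\<^esub> = J"
  "\<lbrakk>x \<in> carrier A; y \<in> carrier A\<rbrakk> \<Longrightarrow> (J +> x) \<otimes>\<^bsub>Q\<^esub> (J +> y) = J +> (x \<otimes> y)"
  "\<lbrakk>x \<in> carrier A; y \<in> carrier A\<rbrakk> \<Longrightarrow> (J +> x) \<oplus>\<^bsub>Q\<^esub> (J +> y) = J +> (x \<oplus> y)"
  "x \<in> carrier A \<Longrightarrow> c \<odot>\<^bsub>Q\<^esub> (J +> x) = J +> (c \<odot> x)"
  "x \<in> carrier A \<Longrightarrow> adj Q (J +> x) = J +> adj A x"
proof -
  show "carrier Q = (+>) J ` carrier A"
    by (auto simp: star_quot_def FactRing_def A_RCOSETS_def' a_r_coset_def)
  show "x \<in> carrier A \<Longrightarrow> c \<odot>\<^bsub>Q\<^esub> (J +> x) = J +> (c \<odot> x)"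
    using Union_coset[of "\<lambda>x. c \<odot> x" x]
    by (simp add: star_quot_def smult_r_distr smult_mem)
  show "x \<in> carrier A \<Longrightarrow> adj Q (J +> x) = J +> adj A x"
    using Union_coset[of "adj A" x] by (simp add: star_quot_def adj_add adj_mem)
qed (simp_all add: star_quot_def FactRing_def rcoset_mult_add a_rcos_sum)

lemma plain_star_algebra_quot: "plain_star_algebra Q"
proof -
  interpret FR: ring "A Quot J" by (rule quotient_is_ring)
  have carr: "carrier Q = carrier (A Quot J)" and
    ops: "\<one>\<^bsub>Q\<^esub> = \<one>\<^bsub>A Quot J\<^esub>" "\<zero>\<^bsub>Q\<^esub> = \<zero>\<^bsub>A Quot J\<^esub>"
      "monoid.mult Q = monoid.mult (A Quot J)" "add Q = add (A Quot J)"
    by (simp_all add: star_quot_def)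
  have "abelian_group Q"
  proof (rule abelian_groupI)
    fix x assume "x \<in> carrier Q"
    then show "\<exists>y\<in>carrier Q. y \<oplus>\<^bsub>Q\<^esub> x = \<zero>\<^bsub>Q\<^esub>"
      by (intro bexI[of _ "\<ominus>\<^bsub>A Quot J\<^esub> x"]) (simp_all add: carr ops FR.l_neg)
  qed (simp_all add: carr ops FR.a_assoc, rule FR.a_comm)
  moreover have "monoid Q"
    by (rule monoidI) (simp_all add: carr ops FR.m_assoc)
  ultimately have "ring Q"
    by (rule ringI) (simp_all add: carr ops FR.l_distr FR.r_distr)
  then show ?thesis
    unfolding plain_star_algebra_def plain_star_algebra_axioms_def
    by (auto simp: quot_simps smult_l_distr smult_r_distr smult_smult smult_mult_left smult_mult_right
        adj_add adj_smult adj_mult)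
qed

lemma coset_pow: "x \<in> carrier A \<Longrightarrow> (J +> x) [^]\<^bsub>Q\<^esub> (n::nat) = J +> (x [^] n)"
proof -
  assume "x \<in> carrier A"
  interpret Q: plain_star_algebra Q by (rule plain_star_algebra_quot)
  show ?thesis
    using \<open>x \<in> carrier A\<close> by (induction n) (simp_all add: quot_simps)
qed

end

text \<open>The adjoint reverses products, so the elements whose adjoint lies in the ideal again
  form a two-sided ideal. It contains \<open>R\<close> and the adjoints of \<open>R\<close>, and
  minimality gives closure under \<open>adj\<close>.\<close>

lemma (in plain_star_algebra) star_ideal_star_idl:
  assumes "R \<subseteq> carrier A"
  shows "star_ideal (star_idl A R) A" and "R \<subseteq> star_idl A R"
proof -
  have R: "R \<union> adj A ` R \<subseteq> carrier A" using assms by auto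
  interpret I: ideal "star_idl A R" A
    unfolding star_idl_def by (rule genideal_ideal[OF R])
  have self: "R \<union> adj A ` R \<subseteq> star_idl A R"
    unfolding star_idl_def by (rule genideal_self[OF R])
  then show "R \<subseteq> star_idl A R" by blast
  let ?T = "{x \<in> carrier A. adj A x \<in> star_idl A R}"
  have "ideal ?T A"
    by (rule idealI_mult) (auto simp: adj_add adj_mult I.I_l_closed I.I_r_closed)
  moreover have "R \<union> adj A ` R \<subseteq> ?T" using self assms by auto
  ultimately have "star_idl A R \<subseteq> ?T"
    unfolding star_idl_def by (rule genideal_minimal)
  then show "star_ideal (star_idl A R) A"
    by (unfold_locales) auto
qed

section \<open>Characters and their descent to quotients\<close>

definition character :: "('a, 'm) star_alg_scheme \<Rightarrow> ('a \<Rightarrow> complex) \<Rightarrow> bool" where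
  "character A \<xi> \<longleftrightarrow> \<xi> \<one>\<^bsub>A\<^esub> = 1 \<and>
     (\<forall>x\<in>carrier A. \<forall>y\<in>carrier A. \<xi> (x \<oplus>\<^bsub>A\<^esub> y) = \<xi> x + \<xi> y \<and> \<xi> (x \<otimes>\<^bsub>A\<^esub> y) = \<xi> x * \<xi> y) \<and>
     (\<forall>x\<in>carrier A. \<xi> (adj A x) = cnj (\<xi> x) \<and> (\<forall>c. \<xi> (c \<odot>\<^bsub>A\<^esub> x) = c * \<xi> x))"

lemma characterD:
  assumes "character A \<xi>"
  shows "\<xi> \<one>\<^bsub>A\<^esub> = 1"
    and "\<lbrakk>x \<in> carrier A; y \<in> carrier A\<rbrakk> \<Longrightarrow> \<xi> (x \<oplus>\<^bsub>A\<^esub> y) = \<xi> x + \<xi> y"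
    and "\<lbrakk>x \<in> carrier A; y \<in> carrier A\<rbrakk> \<Longrightarrow> \<xi> (x \<otimes>\<^bsub>A\<^esub> y) = \<xi> x * \<xi> y"
    and "x \<in> carrier A \<Longrightarrow> \<xi> (adj A x) = cnj (\<xi> x)"
    and "x \<in> carrier A \<Longrightarrow> \<xi> (c \<odot>\<^bsub>A\<^esub> x) = c * \<xi> x"
  using assms by (auto simp: character_def)

context plain_star_algebra
begin

context
  fixes \<xi> assumes \<xi>: "character A \<xi>"
begin

lemma character_zero: "\<xi> \<zero> = 0"
  using characterD(2)[OF \<xi>, of \<zero> \<zero>] by simp

lemma character_minus: "\<lbrakk>x \<in> carrier A; y \<in> carrier A\<rbrakk> \<Longrightarrow> \<xi> (x \<ominus> y) = \<xi> x - \<xi> y"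
  by (simp add: minus_eq_smult characterD[OF \<xi>])

lemma character_pow: "x \<in> carrier A \<Longrightarrow> \<xi> (x [^] (n::nat)) = \<xi> x ^ n"
  by (induction n) (simp_all add: characterD[OF \<xi>])

lemma character_finsum:
  "\<lbrakk>finite B; f \<in> B \<rightarrow> carrier A\<rbrakk> \<Longrightarrow> \<xi> (\<Oplus>i\<in>B. f i) = (\<Sum>i\<in>B. \<xi> (f i))"
  by (induction rule: finite_induct) (auto simp: character_zero characterD[OF \<xi>] finsum_closed)

text \<open>The kernel of a character is an ideal that contains \<open>R\<close>, and also the
  adjoints of \<open>R\<close> because the conjugate of 0 is 0.\<close>

lemma character_star_idl:
  assumes "R \<subseteq> carrier A" "\<And>r. r \<in> R \<Longrightarrow> \<xi> r = 0" "x \<in> star_idl A R"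
  shows "\<xi> x = 0"
proof -
  let ?K = "{x \<in> carrier A. \<xi> x = 0}"
  have "ideal ?K A"
    by (rule idealI_mult) (auto simp: character_zero characterD[OF \<xi>])
  moreover have "R \<union> adj A ` R \<subseteq> ?K" using assms characterD[OF \<xi>] by auto
  ultimately have "star_idl A R \<subseteq> ?K"
    unfolding star_idl_def by (rule genideal_minimal)
  then show ?thesis using assms by blast
qed

end
end

text \<open>No representative is chosen: when the ideal lies in the kernel, the character is
  constant on each coset, so the image is a singleton.\<close>

definition quot_character :: "('a \<Rightarrow> complex) \<Rightarrow> 'a set \<Rightarrow> complex" where
  "quot_character \<xi> Y = the_elem (\<xi> ` Y)"

context star_ideal
begin

lemma quot_character_coset:
  assumes \<xi>: "character A \<xi>" and zero: "\<And>x. x \<in> J \<Longrightarrow> \<xi> x = 0" and x: "x \<in> carrier A"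
  shows "quot_character \<xi> (J +> x) = \<xi> x"
proof -
  have "\<xi> ` (J +> x) = {\<xi> x}"
    using a_rcos_self[OF x] characterD(2)[OF \<xi>] zero x by (fastforce simp: a_r_coset_def')
  then show ?thesis by (simp add: quot_character_def)
qed

lemma character_quot:
  assumes \<xi>: "character A \<xi>" and zero: "\<And>x. x \<in> J \<Longrightarrow> \<xi> x = 0"
  shows "character Q (quot_character \<xi>)"
  unfolding character_def
  using characterD[OF \<xi>] by (auto simp: quot_simps quot_character_coset[OF \<xi> zero])

end

text \<open>Preimages under the quotient map; they reduce generation of a quotient to generation of
  the free algebra.\<close>

lemma (in plain_star_algebra) star_subalgebra_subset_coset:
  fixes J defines "Q \<equiv> star_quot A J"
  assumes "star_ideal J A" and T: "star_subalgebra Q T"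
  shows "star_subalgebra A {x \<in> carrier A. J +> x \<in> T}"
proof -
  interpret star_ideal J A by fact
  show ?thesis
    using T unfolding star_subalgebra_def Q_def by (auto simp flip: quot_simps(2,4-7))
qed

section \<open>Star homomorphisms and induced maps on quotients\<close>

lemma star_homD:
  assumes "h \<in> star_hom A B"
  shows "h \<one>\<^bsub>A\<^esub> = \<one>\<^bsub>B\<^esub>"
    and "x \<in> carrier A \<Longrightarrow> h x \<in> carrier B"
    and "\<lbrakk>x \<in> carrier A; y \<in> carrier A\<rbrakk> \<Longrightarrow> h (x \<oplus>\<^bsub>A\<^esub> y) = h x \<oplus>\<^bsub>B\<^esub> h y"
    and "\<lbrakk>x \<in> carrier A; y \<in> carrier A\<rbrakk> \<Longrightarrow> h (x \<otimes>\<^bsub>A\<^esub> y) = h x \<otimes>\<^bsub>B\<^esub> h y"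
    and "x \<in> carrier A \<Longrightarrow> h (adj A x) = adj B (h x)"
    and "x \<in> carrier A \<Longrightarrow> h (c \<odot>\<^bsub>A\<^esub> x) = c \<odot>\<^bsub>B\<^esub> h x"
  using assms by (auto simp: star_hom_def ring_hom_def)

lemma star_homI:
  assumes "h \<one>\<^bsub>A\<^esub> = \<one>\<^bsub>B\<^esub>"
    and "\<And>x. x \<in> carrier A \<Longrightarrow> h x \<in> carrier B"
    and "\<And>x y. \<lbrakk>x \<in> carrier A; y \<in> carrier A\<rbrakk> \<Longrightarrow> h (x \<oplus>\<^bsub>A\<^esub> y) = h x \<oplus>\<^bsub>B\<^esub> h y"
    and "\<And>x y. \<lbrakk>x \<in> carrier A; y \<in> carrier A\<rbrakk> \<Longrightarrow> h (x \<otimes>\<^bsub>A\<^esub> y) = h x \<otimes>\<^bsub>B\<^esub> h y"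
    and "\<And>x. x \<in> carrier A \<Longrightarrow> h (adj A x) = adj B (h x)"
    and "\<And>c x. x \<in> carrier A \<Longrightarrow> h (c \<odot>\<^bsub>A\<^esub> x) = c \<odot>\<^bsub>B\<^esub> h x"
  shows "h \<in> star_hom A B"
  using assms by (auto simp: star_hom_def ring_hom_def)

lemma star_hom_zero:
  assumes "plain_star_algebra A" "plain_star_algebra B" "h \<in> star_hom A B"
  shows "h \<zero>\<^bsub>A\<^esub> = \<zero>\<^bsub>B\<^esub>"
proof -
  interpret A: plain_star_algebra A by fact
  interpret B: plain_star_algebra B by fact
  have "h (0 \<odot>\<^bsub>A\<^esub> \<one>\<^bsub>A\<^esub>) = 0 \<odot>\<^bsub>B\<^esub> h \<one>\<^bsub>A\<^esub>"
    by (rule star_homD(6)[OF assms(3)]) simp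
  then show ?thesis using star_homD[OF assms(3)] by simp
qed

lemma star_hom_minus:
  assumes "plain_star_algebra A" "plain_star_algebra B" and h: "h \<in> star_hom A B"
    and "x \<in> carrier A" "y \<in> carrier A"
  shows "h (x \<ominus>\<^bsub>A\<^esub> y) = h x \<ominus>\<^bsub>B\<^esub> h y"
proof -
  interpret A: plain_star_algebra A by fact
  interpret B: plain_star_algebra B by fact
  show ?thesis
    using assms(4,5) star_homD(3,6)[OF h]
    by (simp add: A.minus_eq_smult B.minus_eq_smult star_homD(2)[OF h])
qed

lemma star_hom_finsum:
  assumes "plain_star_algebra A" "plain_star_algebra B" and h: "h \<in> star_hom A B"
    and "finite I" "f \<in> I \<rightarrow> carrier A"
  shows "h (\<Oplus>\<^bsub>A\<^esub>i\<in>I. f i) = (\<Oplus>\<^bsub>B\<^esub>i\<in>I. h (f i))"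
proof -
  interpret A: plain_star_algebra A by fact
  interpret B: plain_star_algebra B by fact
  show ?thesis
    using assms(4,5)
  proof (induction rule: finite_induct)
    case (insert i I)
    then have "f \<in> I \<rightarrow> carrier A" "f i \<in> carrier A" by auto
    moreover have "(\<lambda>i. h (f i)) \<in> I \<rightarrow> carrier B" "h (f i) \<in> carrier B"
      using calculation star_homD[OF h] by auto
    ultimately show ?case
      using insert by (simp add: star_homD[OF h])
  qed (simp add: star_hom_zero[OF assms(1-3)])
qed

lemma star_isoD:
  assumes "h \<in> star_iso A B"
  shows "h \<in> star_hom A B" "inj_on h (carrier A)" "h ` carrier A = carrier B"
  using assms by (auto simp: star_iso_def bij_betw_def)

lemma star_iso_inv:
  assumes "plain_star_algebra A" "plain_star_algebra B" "h \<in> star_iso A B"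
  shows "inv_into (carrier A) h \<in> star_iso B A"
proof -
  interpret A: plain_star_algebra A by fact
  interpret B: plain_star_algebra B by fact
  note h = star_isoD[OF assms(3)]
  note hom = star_homD[OF h(1)]
  let ?g = "inv_into (carrier A) h"
  have g: "h (?g y) = y" "?g y \<in> carrier A" if "y \<in> carrier B" for y
    using h(3) that by (auto intro: f_inv_into_f inv_into_into)
  have "bij_betw ?g (carrier B) (carrier A)"
    using h by (metis bij_betw_imageI bij_betw_inv_into)
  moreover have "?g \<in> star_hom B A"
    by (rule star_homI) (auto intro!: inj_onD[OF h(2)] simp: g hom)
  ultimately show ?thesis by (simp add: star_iso_def)
qed

text \<open>The elements sent into the target ideal form an ideal containing \<open>R\<close> and
  its adjoints, so minimality applies.\<close>

lemma star_hom_star_idl: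
  assumes "plain_star_algebra A" "plain_star_algebra B" and h: "h \<in> star_hom A B"
    and R: "R \<subseteq> carrier A"
  shows "h ` star_idl A R \<subseteq> star_idl B (h ` R)"
proof -
  interpret A: plain_star_algebra A by fact
  interpret B: plain_star_algebra B by fact
  note hom = star_homD[OF h]
  have hR: "h ` R \<subseteq> carrier B" using R hom by auto
  interpret I: star_ideal "star_idl B (h ` R)" B by (rule B.star_ideal_star_idl[OF hR])
  let ?T = "{x \<in> carrier A. h x \<in> star_idl B (h ` R)}"
  have "ideal ?T A"
    by (rule A.idealI_mult)
      (auto simp: hom star_hom_zero[OF assms(1-3)] I.I_l_closed I.I_r_closed)
  moreover have "R \<union> adj A ` R \<subseteq> ?T"
    using B.star_ideal_star_idl(2)[OF hR] I.adj_mem by (auto simp: hom subsetD[OF R])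
  ultimately show ?thesis
    unfolding star_idl_def[of A] by (blast dest: A.genideal_minimal)
qed

text \<open>The inclusion for \<open>h\<close> is applied a second time to its inverse, with
  \<open>R\<close> and its image exchanged.\<close>

lemma star_iso_star_idl:
  assumes "plain_star_algebra A" "plain_star_algebra B" "h \<in> star_iso A B" "R \<subseteq> carrier A"
  shows "h ` star_idl A R = star_idl B (h ` R)"
proof
  note h = star_isoD[OF assms(3)]
  let ?g = "inv_into (carrier A) h"
  have g: "?g \<in> star_hom B A" by (rule star_isoD(1)[OF star_iso_inv[OF assms(1-3)]])
  have hR: "h ` R \<subseteq> carrier B" using h assms(4) by auto
  have gR: "?g ` (h ` R) = R"
    using h(2) assms(4) by (simp add: inv_into_image_cancel)
  interpret B: plain_star_algebra B by fact
  interpret I: star_ideal "star_idl B (h ` R)" B by (rule B.star_ideal_star_idl[OF hR])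
  have "star_idl B (h ` R) = h ` ?g ` star_idl B (h ` R)"
    using h(3) I.a_subset by (simp add: image_inv_into_cancel)
  also have "\<dots> \<subseteq> h ` star_idl A R"
    using star_hom_star_idl[OF assms(2,1) g hR] unfolding gR by (rule image_mono)
  finally show "star_idl B (h ` R) \<subseteq> h ` star_idl A R" .
  show "h ` star_idl A R \<subseteq> star_idl B (h ` R)"
    by (rule star_hom_star_idl[OF assms(1,2) h(1) assms(4)])
qed

text \<open>Cosets are sets, so the induced map is \<open>image h\<close>: it carries ideal to
  ideal, hence cosets to cosets, and is injective on subsets of the carrier.\<close>

lemma star_quot_iso:
  assumes "plain_star_algebra A" "plain_star_algebra B" "h \<in> star_iso A B" "R \<subseteq> carrier A"
  shows "image h \<in> star_iso (star_quot A (star_idl A R)) (star_quot B (star_idl B (h ` R)))"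
    and "x \<in> carrier A \<Longrightarrow> h ` (star_idl A R +>\<^bsub>A\<^esub> x) = star_idl B (h ` R) +>\<^bsub>B\<^esub> h x"
proof -
  interpret A: plain_star_algebra A by fact
  interpret B: plain_star_algebra B by fact
  note h = star_isoD[OF assms(3)]
  note hom = star_homD[OF h(1)]
  interpret I: star_ideal "star_idl A R" A by (rule A.star_ideal_star_idl[OF assms(4)])
  have hR: "h ` R \<subseteq> carrier B" using h assms(4) by auto
  interpret K: star_ideal "star_idl B (h ` R)" B by (rule B.star_ideal_star_idl[OF hR])
  have coset: "h ` (star_idl A R +>\<^bsub>A\<^esub> x) = star_idl B (h ` R) +>\<^bsub>B\<^esub> h x" if "x \<in> carrier A" for x
  proof -
    have "h ` (star_idl A R +>\<^bsub>A\<^esub> x) = (\<lambda>j. h j \<oplus>\<^bsub>B\<^esub> h x) ` star_idl A R"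
      using that by (force simp: a_r_coset_def' hom image_iff)
    also have "\<dots> = (\<lambda>j. j \<oplus>\<^bsub>B\<^esub> h x) ` h ` star_idl A R" by (simp add: image_image)
    also have "\<dots> = star_idl B (h ` R) +>\<^bsub>B\<^esub> h x"
      unfolding star_iso_star_idl[OF assms] by (auto simp: a_r_coset_def')
    finally show ?thesis .
  qed
  then show "x \<in> carrier A \<Longrightarrow> h ` (star_idl A R +>\<^bsub>A\<^esub> x) = star_idl B (h ` R) +>\<^bsub>B\<^esub> h x" .
  have "image h \<in> star_hom I.Q K.Q"
    by (rule star_homI) (auto simp: I.quot_simps K.quot_simps coset hom del: subset_antisym)
  moreover have "inj_on (image h) (carrier I.Q)"
    by (rule inj_on_subset[OF inj_on_image_Pow[OF h(2)]])
      (auto simp: I.quot_simps dest: subsetD[OF A.a_r_coset_subset_G[OF I.a_subset]])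
  moreover have "image h ` carrier I.Q = carrier K.Q"
    unfolding I.quot_simps K.quot_simps h(3)[symmetric] image_image
    by (rule image_cong) (simp_all add: coset)
  ultimately show "image h \<in> star_iso I.Q K.Q"
    by (simp add: star_iso_def bij_betw_def)
qed

section \<open>Algebras of functions on a finite set\<close>

text \<open>\<open>\<xi>\<close> evaluates at the points of \<open>C\<close>, and \<open>P\<close>
  gives the indicator functions of the points. For empty \<open>C\<close> the condition
  \<open>separating\<close> forces the zero algebra, so unsatisfiable constraints are
  covered.\<close>

locale coordinates = plain_star_algebra A
  for A :: "('a, 'm) star_alg_scheme" (structure) +
  fixes C :: "'c set" and P :: "'c \<Rightarrow> 'a" and \<xi> :: "'c \<Rightarrow> 'a \<Rightarrow> complex"
  assumes finite_C: "finite C"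
    and character: "\<phi> \<in> C \<Longrightarrow> character A (\<xi> \<phi>)"
    and P_closed: "\<phi> \<in> C \<Longrightarrow> P \<phi> \<in> carrier A"
    and character_P: "\<lbrakk>\<phi> \<in> C; \<psi> \<in> C\<rbrakk> \<Longrightarrow> \<xi> \<phi> (P \<psi>) = (if \<phi> = \<psi> then 1 else 0)"
    and separating: "\<lbrakk>p \<in> carrier A; \<And>\<phi>. \<phi> \<in> C \<Longrightarrow> \<xi> \<phi> p = 0\<rbrakk> \<Longrightarrow> p = \<zero>"
begin

lemma eqI:
  assumes "p \<in> carrier A" "q \<in> carrier A" "\<And>\<phi>. \<phi> \<in> C \<Longrightarrow> \<xi> \<phi> p = \<xi> \<phi> q"
  shows "p = q"
  using separating[of "p \<ominus> q"] assms character by (simp add: character_minus)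

text \<open>Existence is interpolation by indicator functions; uniqueness is separation of elements
  by points.\<close>

lemma ex1_coordinates: "\<exists>!p. p \<in> carrier A \<and> (\<forall>\<phi>\<in>C. \<xi> \<phi> p = f \<phi>)"
proof -
  let ?p = "\<Oplus>\<psi>\<in>C. f \<psi> \<odot> P \<psi>"
  have "\<xi> \<phi> ?p = f \<phi>" if "\<phi> \<in> C" for \<phi>
  proof -
    have "\<xi> \<phi> ?p = (\<Sum>\<psi>\<in>C. \<xi> \<phi> (f \<psi> \<odot> P \<psi>))"
      using P_closed finite_C that character by (intro character_finsum) auto
    also have "\<dots> = (\<Sum>\<psi>\<in>C. if \<phi> = \<psi> then f \<psi> else 0)"
      using that P_closed by (intro sum.cong) (simp_all add: characterD[OF character[OF that]] character_P)
    finally show ?thesis using finite_C that by simp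
  qed
  moreover have "?p \<in> carrier A" using P_closed by (auto intro: finsum_closed)
  ultimately show ?thesis using eqI by (intro ex1I[of _ ?p]) auto
qed

end

text \<open>\<open>h p\<close> is the element whose value at \<open>\<sigma> \<phi>\<close> is the
  value of \<open>p\<close> at \<open>\<phi>\<close>. Characters preserve all operations, so each
  homomorphism law becomes an identity of complex numbers at every point.\<close>

lemma coordinates_iso:
  assumes "coordinates A C P \<xi>" "coordinates B D R \<eta>" and \<sigma>: "bij_betw \<sigma> C D"
  obtains h where "h \<in> star_iso A B" "\<And>\<phi>. \<phi> \<in> C \<Longrightarrow> h (P \<phi>) = R (\<sigma> \<phi>)"
proof -
  interpret A: coordinates A C P \<xi> by fact
  interpret B: coordinates B D R \<eta> by fact
  have \<sigma>_mem: "\<sigma> \<phi> \<in> D" if "\<phi> \<in> C" for \<phi> using \<sigma> that by (auto simp: bij_betw_def)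
  have inj: "\<sigma> \<phi> = \<sigma> \<psi> \<longleftrightarrow> \<phi> = \<psi>" if "\<phi> \<in> C" "\<psi> \<in> C" for \<phi> \<psi>
    using \<sigma> that by (auto simp: bij_betw_def inj_on_def)
  have D: "D = \<sigma> ` C" using \<sigma> by (simp add: bij_betw_def)
  define h where "h p = (THE q. q \<in> carrier B \<and> (\<forall>\<psi>\<in>D. \<eta> \<psi> q = \<xi> (inv_into C \<sigma> \<psi>) p))" for p
  have h: "h p \<in> carrier B \<and> (\<forall>\<psi>\<in>D. \<eta> \<psi> (h p) = \<xi> (inv_into C \<sigma> \<psi>) p)" for p
    unfolding h_def by (rule theI') (rule B.ex1_coordinates)
  have \<eta>h: "\<eta> (\<sigma> \<phi>) (h p) = \<xi> \<phi> p" if "\<phi> \<in> C" for \<phi> p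
    using h \<sigma> \<sigma>_mem[OF that] that by (simp add: bij_betw_inv_into_left)
  have eqI: "p = q" if "p \<in> carrier B" "q \<in> carrier B" "\<And>\<phi>. \<phi> \<in> C \<Longrightarrow> \<eta> (\<sigma> \<phi>) p = \<eta> (\<sigma> \<phi>) q" for p q
    using that unfolding D by (intro B.eqI) (auto simp: D)
  note chars = characterD[OF A.character] characterD[OF B.character[OF \<sigma>_mem]]
  have "h \<in> star_hom A B"
    by (rule star_homI) (auto intro!: eqI simp: h \<eta>h chars)
  moreover have "inj_on h (carrier A)"
    by (rule inj_onI) (metis A.eqI \<eta>h)
  moreover have "q \<in> h ` carrier A" if "q \<in> carrier B" for q
  proof -
    obtain p where "p \<in> carrier A" "\<forall>\<phi>\<in>C. \<xi> \<phi> p = \<eta> (\<sigma> \<phi>) q"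
      using A.ex1_coordinates[of "\<lambda>\<phi>. \<eta> (\<sigma> \<phi>) q"] by blast
    then show ?thesis
      using that h by (intro image_eqI[of _ _ p] eqI) (auto simp: \<eta>h)
  qed
  ultimately have "h \<in> star_iso A B"
    using h by (auto simp: star_iso_def bij_betw_def)
  moreover have "h (P \<phi>) = R (\<sigma> \<phi>)" if "\<phi> \<in> C" for \<phi>
    using that B.P_closed \<sigma>_mem
    by (intro eqI) (auto simp: \<eta>h conjunct1[OF h] A.P_closed A.character_P B.character_P inj)
  ultimately show thesis by (rule that)
qed

section \<open>Constraint algebras as function algebras\<close>

definition letter_val :: "('g \<Rightarrow> complex) \<Rightarrow> 'g \<times> bool \<Rightarrow> complex" where
  "letter_val f l = (if snd l then cnj (f (fst l)) else f (fst l))"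

definition word_val :: "('g \<Rightarrow> complex) \<Rightarrow> ('g \<times> bool) list \<Rightarrow> complex" where
  "word_val f w = prod_list (map (letter_val f) w)"

definition free_eval :: "('g \<Rightarrow> complex) \<Rightarrow> 'g free_elem \<Rightarrow> complex" where
  "free_eval f p = (\<Sum>w | p w \<noteq> 0. p w * word_val f w)"

lemma word_val_append: "word_val f (u @ v) = word_val f u * word_val f v"
  by (simp add: word_val_def)

lemma word_val_flip: "word_val f (flip_word w) = cnj (word_val f w)"
  by (induction w) (auto simp: word_val_def letter_val_def apsnd_def map_prod_def split_beta)

lemma free_eval_eq:
  assumes "finite W" "{w. p w \<noteq> 0} \<subseteq> W"
  shows "free_eval f p = (\<Sum>w\<in>W. p w * word_val f w)"
  unfolding free_eval_def by (rule sum.mono_neutral_left) (use assms in auto)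

lemma free_eval_gen: "free_eval f (free_gen g) = f g"
  by (subst free_eval_eq[of "{[(g, False)]}"]) (auto simp: free_gen_def word_val_def letter_val_def)

lemma character_free_eval: "character (free_star_algebra G) (free_eval f)"
proof -
  let ?F = "free_star_algebra G"
  note defs = free_star_algebra_simps free_star_algebra_carrier_iff
  have "free_eval f \<one>\<^bsub>?F\<^esub> = 1"
    by (subst free_eval_eq[of "{[]}"]) (auto simp: defs word_val_def)
  moreover have "free_eval f (p \<oplus>\<^bsub>?F\<^esub> q) = free_eval f p + free_eval f q"
    if "p \<in> carrier ?F" "q \<in> carrier ?F" for p q
  proof -
    let ?W = "{w. p w \<noteq> 0} \<union> {w. q w \<noteq> 0}"
    have fin: "finite ?W" using that by (simp add: defs)
    show ?thesis
      by (subst (1 2 3) free_eval_eq[OF fin])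
        (auto simp: defs sum.distrib algebra_simps)
  qed
  moreover have "free_eval f (p \<otimes>\<^bsub>?F\<^esub> q) = free_eval f p * free_eval f q"
    if "p \<in> carrier ?F" "q \<in> carrier ?F" for p q
  proof -
    let ?P = "{w. p w \<noteq> 0}" and ?Q = "{w. q w \<noteq> 0}"
    \<comment> \<open>Contains the support of the product, which cancellation can make smaller than
      this set.\<close>
    let ?W = "(\<lambda>(u, v). u @ v) ` (?P \<times> ?Q)"
    have fin: "finite ?P" "finite ?Q" using that by (simp_all add: defs)
    have "{w. conv p q w \<noteq> 0} \<subseteq> ?W" by (auto elim!: conv_support)
    then have "free_eval f (p \<otimes>\<^bsub>?F\<^esub> q) = (\<Sum>w\<in>?W. conv p q w * word_val f w)"
      using fin by (subst free_eval_eq[of ?W]) (auto simp: defs)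
    also have "\<dots> = (\<Sum>w\<in>?W. \<Sum>x\<in>{x \<in> ?P \<times> ?Q. (\<lambda>(u, v). u @ v) x = w}.
        (p (fst x) * word_val f (fst x)) * (q (snd x) * word_val f (snd x)))"
    proof (rule sum.cong[OF refl])
      fix w
      have "conv p q w * word_val f w =
          (\<Sum>(u, v) \<in> {(u, v) \<in> ?P \<times> ?Q. u @ v = w}. p u * q v * word_val f w)"
        by (subst conv_eq_sum[OF fin]) (auto simp: sum_distrib_right split_beta)
      also have "\<dots> = (\<Sum>x\<in>{x \<in> ?P \<times> ?Q. (\<lambda>(u, v). u @ v) x = w}.
          (p (fst x) * word_val f (fst x)) * (q (snd x) * word_val f (snd x)))"
        by (rule sum.cong) (auto simp: word_val_append)
      finally show "conv p q w * word_val f w = \<dots>" .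
    qed
    \<comment> \<open>The fibres of concatenation partition the pairs of support words, so the
      double sum runs over all pairs once.\<close>
    also have "\<dots> = (\<Sum>x\<in>?P \<times> ?Q. (p (fst x) * word_val f (fst x)) * (q (snd x) * word_val f (snd x)))"
      using fin by (intro sum.group) auto
    also have "\<dots> = free_eval f p * free_eval f q"
      by (simp add: free_eval_def sum_product sum.cartesian_product split_beta)
    finally show ?thesis .
  qed
  moreover have "free_eval f (adj ?F p) = cnj (free_eval f p)" if "p \<in> carrier ?F" for p
  proof -
    have "free_eval f (adj ?F p) = (\<Sum>w | p (flip_word w) \<noteq> 0. cnj (p (flip_word w)) * word_val f w)"
      by (simp add: free_eval_def defs)
    also have "\<dots> = (\<Sum>w | p w \<noteq> 0. cnj (p w * word_val f w))"
      by (rule sum.reindex_bij_witness[of _ flip_word flip_word])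
        (simp_all flip: word_val_flip)
    finally show ?thesis by (simp add: free_eval_def)
  qed
  moreover have "free_eval f (c \<odot>\<^bsub>?F\<^esub> p) = c * free_eval f p" if "p \<in> carrier ?F" for c p
    using that
    by (subst free_eval_eq[of "{w. p w \<noteq> 0}"]) (auto simp: defs free_eval_def sum_distrib_left mult_ac)
  ultimately show ?thesis unfolding character_def by blast
qed

section \<open>Commutation and eigenvector conditions\<close>

text \<open>Lets commutation be checked on generators. For adjoints: \<open>p\<close> commutes with
  \<open>adj A s\<close>, which is again in \<open>S\<close>, and the adjoint of that equation says
  that \<open>adj A p\<close> commutes with \<open>s\<close>.\<close>

lemma (in plain_star_algebra) star_subalgebra_centralizer:
  assumes S: "S \<subseteq> carrier A" "adj A ` S \<subseteq> S"
  shows "star_subalgebra A {p \<in> carrier A. \<forall>s\<in>S. p \<otimes> s = s \<otimes> p}"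
proof -
  have adj: "adj A p \<otimes> s = s \<otimes> adj A p"
    if p: "p \<in> carrier A" "\<forall>s\<in>S. p \<otimes> s = s \<otimes> p" and s: "s \<in> S" for p s
  proof -
    have "s \<in> carrier A" "adj A s \<in> S" using S s by auto
    then have "adj A (adj A s \<otimes> p) = adj A (p \<otimes> adj A s)" using p by simp
    then show ?thesis using \<open>s \<in> carrier A\<close> p(1) by (simp add: adj_mult)
  qed
  have "p \<otimes> q \<otimes> s = s \<otimes> (p \<otimes> q)"
    if "p \<in> carrier A" "p \<otimes> s = s \<otimes> p" "q \<in> carrier A" "q \<otimes> s = s \<otimes> q" "s \<in> S" for p q s
    using that subsetD[OF S(1)] by (metis m_assoc)
  then show ?thesis
    using adj subsetD[OF S(1)]
    by (auto simp: star_subalgebra_def l_distr r_distr smult_mult_left smult_mult_right)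
qed

text \<open>The condition on \<open>adj A p\<close> stands beside the one on \<open>p\<close> so
  that the set is closed under adjoints.\<close>

lemma (in plain_star_algebra) star_subalgebra_eigenspace:
  assumes \<xi>: "character A \<xi>" and P: "P \<in> carrier A"
  shows "star_subalgebra A
    {p \<in> carrier A. p \<otimes> P = \<xi> p \<odot> P \<and> adj A p \<otimes> P = cnj (\<xi> p) \<odot> P}"
  using P
  by (auto simp: star_subalgebra_def characterD[OF \<xi>] l_distr smult_l_distr smult_mult_left
      smult_smult adj_add adj_smult adj_mult m_assoc smult_mult_right mult_ac)

section \<open>Polynomials in one element\<close>

context plain_star_algebra
begin

text \<open>A polynomial of degree below \<open>k\<close>. The coefficients live on all naturals, so
  the value \<open>c k\<close> just past the end is available to the shift argument in
  \<open>mult_power_sum\<close>.\<close>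

definition power_sum :: "'a \<Rightarrow> nat \<Rightarrow> (nat \<Rightarrow> complex) \<Rightarrow> 'a" where
  "power_sum x k c = (\<Oplus>n\<in>{..<k}. c n \<odot> x [^] n)"

context
  fixes x assumes x: "x \<in> carrier A"
begin

lemma power_sum_closed [simp]: "power_sum x k c \<in> carrier A"
  unfolding power_sum_def using x by (intro finsum_closed) auto

lemma power_sum_0 [simp]: "power_sum x 0 c = \<zero>"
  by (simp add: power_sum_def)

lemma power_sum_Suc: "power_sum x (Suc k) c = c k \<odot> x [^] k \<oplus> power_sum x k c"
  unfolding power_sum_def lessThan_Suc using x by (intro finsum_insert) auto

lemma power_sum_add: "power_sum x k c \<oplus> power_sum x k d = power_sum x k (\<lambda>n. c n + d n)"
proof (induction k)
  case (Suc k)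
  show ?case
    using x by (simp add: power_sum_Suc smult_l_distr a_ac flip: Suc)
qed simp

lemma power_sum_smult: "r \<odot> power_sum x k c = power_sum x k (\<lambda>n. r * c n)"
  by (induction k) (use x in \<open>simp_all add: power_sum_Suc smult_r_distr smult_smult\<close>)

lemma power_sum_zero: "power_sum x k (\<lambda>n. 0) = \<zero>"
  by (induction k) (use x in \<open>simp_all add: power_sum_Suc\<close>)

lemma power_sum_sum:
  "finite B \<Longrightarrow> (\<Oplus>b\<in>B. power_sum x k (c b)) = power_sum x k (\<lambda>n. \<Sum>b\<in>B. c b n)"
  by (induction rule: finite_induct) (simp_all add: power_sum_zero power_sum_add)

lemma power_sum_cong: "(\<And>n. n < k \<Longrightarrow> c n = d n) \<Longrightarrow> power_sum x k c = power_sum x k d"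
  unfolding power_sum_def using x by (intro finsum_cong') auto

lemma power_sum_unit:
  assumes "0 < k"
  shows "power_sum x k (\<lambda>n. if n = 0 then 1 else 0) = \<one>"
proof -
  have "power_sum x (Suc m) (\<lambda>n. if n = 0 then 1 else 0) = \<one>" for m
    by (induction m) (use x in \<open>simp_all add: power_sum_Suc[of "Suc _"]\<close>, simp add: power_sum_Suc)
  then show ?thesis using assms by (metis gr0_implies_Suc)
qed

text \<open>For geometric coefficients, multiplication by \<open>x\<close> shifts the index at the
  cost of a factor \<open>r\<close>. The leftover terms for exponents 0 and \<open>k\<close> stay on
  opposite sides, so the induction on \<open>k\<close> runs before any periodicity is
  assumed.\<close>

lemma mult_power_sum:
  assumes "\<And>n. c n = r * c (Suc n)"
  shows "x \<otimes> power_sum x k c \<oplus> r \<odot> (c 0 \<odot> \<one>) = r \<odot> (power_sum x k c \<oplus> c k \<odot> x [^] k)"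
proof (induction k)
  case 0
  then show ?case using x by simp
next
  case (Suc k)
  have "x \<otimes> power_sum x (Suc k) c \<oplus> r \<odot> (c 0 \<odot> \<one>) =
      x \<otimes> (c k \<odot> x [^] k) \<oplus> (x \<otimes> power_sum x k c \<oplus> r \<odot> (c 0 \<odot> \<one>))"
    using x by (simp add: power_sum_Suc r_distr a_assoc)
  also have "x \<otimes> (c k \<odot> x [^] k) = r \<odot> (c (Suc k) \<odot> x [^] Suc k)"
    using x assms[of k] nat_pow_Suc2[OF x] by (simp add: smult_mult_right smult_smult)
  also have "r \<odot> (c (Suc k) \<odot> x [^] Suc k) \<oplus> (x \<otimes> power_sum x k c \<oplus> r \<odot> (c 0 \<odot> \<one>)) =
      r \<odot> (power_sum x (Suc k) c \<oplus> c (Suc k) \<odot> x [^] Suc k)"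
    unfolding Suc using x by (simp add: power_sum_Suc smult_r_distr a_ac del: nat_pow_Suc)
  finally show ?case .
qed

text \<open>Periodicity makes the two leftover terms of \<open>mult_power_sum\<close> equal, and
  they cancel.\<close>

lemma power_sum_eigenvector:
  assumes "\<And>n. c n = r * c (Suc n)" "c k = c 0" "x [^] k = \<one>"
  shows "x \<otimes> power_sum x k c = r \<odot> power_sum x k c"
proof -
  have "x \<otimes> power_sum x k c \<oplus> r \<odot> (c 0 \<odot> \<one>) = r \<odot> power_sum x k c \<oplus> r \<odot> (c 0 \<odot> \<one>)"
    using mult_power_sum[where c = c and r = r and k = k, OF assms(1)] by (simp add: assms(2,3) smult_r_distr)
  then show ?thesis using x by simp
qed

lemma character_power_sum:
  assumes \<xi>: "character A \<xi>"
  shows "\<xi> (power_sum x k c) = (\<Sum>n<k. c n * \<xi> x ^ n)"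
  by (induction k) (use x in \<open>simp_all add: power_sum_Suc characterD[OF \<xi>] character_zero[OF \<xi>] character_pow[OF \<xi>]\<close>)

end
end

section \<open>Roots of unity\<close>

lemma root_unity_pow: "root_unity k ^ n = cis (2 * pi * real n / real k)"
  by (simp add: root_unity_def exp_of_nat_mult[symmetric] cis_conv_exp mult_ac)

lemma root_unity_power_k: "k > 0 \<Longrightarrow> root_unity k ^ k = 1"
  by (simp add: root_unity_pow cis_2pi)

lemma root_unity_nonzero [simp]: "root_unity k \<noteq> 0"
  by (simp add: root_unity_def)

lemma cnj_root_unity_mult: "cnj (root_unity k ^ n) * root_unity k ^ n = 1"
  by (simp add: root_unity_pow cis_mult cis_cnj)

lemma root_unity_pow_eq_iff:
  assumes "a < k" "b < k"
  shows "root_unity k ^ a = root_unity k ^ b \<longleftrightarrow> a = b"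
  using Complex.bij_betw_roots_unity[of k] assms by (auto simp: root_unity_pow bij_betw_def inj_on_def)

text \<open>Orthogonality of the characters of the cyclic group: off the diagonal the quotient is a
  k-th root of unity other than 1, so its geometric sum vanishes. It is used both to add up spectral
  projections (with \<open>b = 0\<close>) and to evaluate them.\<close>

lemma root_unity_sum:
  assumes "a < k" "b < k"
  shows "(\<Sum>n<k. 1 / of_nat k * (root_unity k ^ b / root_unity k ^ a) ^ n) = (if a = b then 1 else 0)"
proof (cases "a = b")
  case False
  let ?z = "root_unity k ^ b / root_unity k ^ a"
  have "?z \<noteq> 1" using False root_unity_pow_eq_iff[OF assms] by (auto simp: divide_eq_1_iff)
  moreover have "?z ^ k = 1"
  proof -
    have "(root_unity k ^ c) ^ k = 1" for c
      using root_unity_power_k[of k] assms by (metis gr_implies_not0 mult.commute not_gr0 power_mult power_one)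
    then show ?thesis by (simp add: power_divide)
  qed
  ultimately have "(\<Sum>n<k. ?z ^ n) = 0" by (simp add: geometric_sum)
  then show ?thesis using False by (simp flip: sum_divide_distrib)
qed (use assms in simp)

section \<open>The algebra of commuting unitaries with k-th power 1\<close>

definition cyc_relations :: "nat \<Rightarrow> 'x set \<Rightarrow> 'x free_elem set" where
  "cyc_relations k V =
    (let F = free_star_algebra V; g = free_gen in
      {(g x \<otimes>\<^bsub>F\<^esub> g y) \<ominus>\<^bsub>F\<^esub> (g y \<otimes>\<^bsub>F\<^esub> g x) |x y. x \<in> V \<and> y \<in> V} \<union>
      {(adj F (g x) \<otimes>\<^bsub>F\<^esub> g x) \<ominus>\<^bsub>F\<^esub> \<one>\<^bsub>F\<^esub> |x. x \<in> V} \<union>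
      {(g x \<otimes>\<^bsub>F\<^esub> adj F (g x)) \<ominus>\<^bsub>F\<^esub> \<one>\<^bsub>F\<^esub> |x. x \<in> V} \<union>
      {(g x [^]\<^bsub>F\<^esub> k) \<ominus>\<^bsub>F\<^esub> \<one>\<^bsub>F\<^esub> |x. x \<in> V})"

definition cyc_eval :: "nat \<Rightarrow> ('x \<Rightarrow> nat) \<Rightarrow> 'x cyc_elem \<Rightarrow> complex" where
  "cyc_eval k \<phi> = quot_character (free_eval (\<lambda>x. root_unity k ^ \<phi> x))"

locale cyclic_algebra =
  fixes k :: nat and V :: "'x set"
  assumes k_pos: "0 < k" and finite_V: "finite V"
begin

abbreviation Z :: "'x cyc_elem star_alg" where "Z \<equiv> cyc_algebra k V"
abbreviation gen :: "'x \<Rightarrow> 'x cyc_elem" where "gen \<equiv> cyc_gen k V"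

lemma plain_F: "plain_star_algebra (free_star_algebra V)"
  by (rule plain_star_algebra_free)

lemma cyc_relations_closed: "cyc_relations k V \<subseteq> carrier (free_star_algebra V)"
proof -
  interpret F: plain_star_algebra "free_star_algebra V" by (rule plain_F)
  show ?thesis by (auto simp: cyc_relations_def Let_def)
qed

lemma cyc_ideal_eq: "cyc_ideal k V = star_idl (free_star_algebra V) (cyc_relations k V)"
  by (simp add: cyc_ideal_def cyc_relations_def Let_def)

lemma star_ideal_cyc: "star_ideal (cyc_ideal k V) (free_star_algebra V)"
  unfolding cyc_ideal_eq
  by (rule plain_star_algebra.star_ideal_star_idl[OF plain_F cyc_relations_closed])

lemma cyc_relations_ideal: "cyc_relations k V \<subseteq> cyc_ideal k V"
  unfolding cyc_ideal_eq
  by (rule plain_star_algebra.star_ideal_star_idl[OF plain_F cyc_relations_closed])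

lemma plain_Z: "plain_star_algebra Z"
  unfolding cyc_algebra_def by (rule star_ideal.plain_star_algebra_quot[OF star_ideal_cyc])

lemma gen_closed [simp]: "x \<in> V \<Longrightarrow> gen x \<in> carrier Z"
  using star_ideal.quot_simps(1)[OF star_ideal_cyc] by (simp add: cyc_algebra_def cyc_gen_def)

lemma gen_relations:
  assumes "x \<in> V"
  shows "y \<in> V \<Longrightarrow> gen x \<otimes>\<^bsub>Z\<^esub> gen y = gen y \<otimes>\<^bsub>Z\<^esub> gen x"
    and "adj Z (gen x) \<otimes>\<^bsub>Z\<^esub> gen x = \<one>\<^bsub>Z\<^esub>"
    and "gen x \<otimes>\<^bsub>Z\<^esub> adj Z (gen x) = \<one>\<^bsub>Z\<^esub>"
    and "gen x [^]\<^bsub>Z\<^esub> k = \<one>\<^bsub>Z\<^esub>"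
proof -
  interpret F: plain_star_algebra "free_star_algebra V" by (rule plain_F)
  interpret I: star_ideal "cyc_ideal k V" "free_star_algebra V" by (rule star_ideal_cyc)
  note defs = cyc_algebra_def cyc_gen_def I.quot_simps I.coset_pow I.coset_eq_iff
  note mem = subsetD[OF cyc_relations_ideal, unfolded cyc_relations_def Let_def]
  show "y \<in> V \<Longrightarrow> gen x \<otimes>\<^bsub>Z\<^esub> gen y = gen y \<otimes>\<^bsub>Z\<^esub> gen x"
    using assms by (simp add: defs) (rule mem, blast)
  show "adj Z (gen x) \<otimes>\<^bsub>Z\<^esub> gen x = \<one>\<^bsub>Z\<^esub>"
    using assms by (simp add: defs) (rule mem, blast)
  show "gen x \<otimes>\<^bsub>Z\<^esub> adj Z (gen x) = \<one>\<^bsub>Z\<^esub>"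
    using assms by (simp add: defs) (rule mem, blast)
  show "gen x [^]\<^bsub>Z\<^esub> k = \<one>\<^bsub>Z\<^esub>"
    using assms by (simp add: defs) (rule mem, blast)
qed

lemma Z_generated:
  assumes T: "star_subalgebra Z T" and gens: "gen ` V \<subseteq> T"
  shows "T = carrier Z"
proof -
  let ?F = "free_star_algebra V" and ?I = "cyc_ideal k V"
  let ?T = "{p \<in> carrier ?F. ?I +>\<^bsub>?F\<^esub> p \<in> T}"
  have "star_subalgebra ?F ?T"
    using T unfolding cyc_algebra_def
    by (rule plain_star_algebra.star_subalgebra_subset_coset[OF plain_F star_ideal_cyc])
  moreover have "free_gen ` V \<subseteq> ?T" using gens by (auto simp: cyc_gen_def)
  ultimately have "?T = carrier ?F" by (rule free_star_algebra_generated)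
  then have "carrier Z \<subseteq> T"
    using star_ideal.quot_simps(1)[OF star_ideal_cyc] by (auto simp: cyc_algebra_def)
  then show ?thesis using T by (auto simp: star_subalgebra_def)
qed

text \<open>Two rounds of centralizers: generators commute with generators and their adjoints, hence
  every element does; so generators commute with every element, hence again every element
  does.\<close>

lemma cring_Z: "cring Z"
proof -
  interpret Z: plain_star_algebra Z by (rule plain_Z)
  let ?S = "gen ` V \<union> adj Z ` gen ` V"
  have S: "?S \<subseteq> carrier Z" "adj Z ` ?S \<subseteq> ?S" by auto
  \<comment> \<open>Unitarity extends commutation to adjoints: insert
    \<open>?u \<otimes> gen x\<close> on the left, exchange the two generators, and cancel
    \<open>gen x\<close> against \<open>?u\<close> on the right.\<close>
  have "gen y \<otimes>\<^bsub>Z\<^esub> adj Z (gen x) = adj Z (gen x) \<otimes>\<^bsub>Z\<^esub> gen y" if "x \<in> V" "y \<in> V" for x y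
  proof -
    let ?u = "adj Z (gen x)"
    have "gen y \<otimes>\<^bsub>Z\<^esub> ?u = (?u \<otimes>\<^bsub>Z\<^esub> gen x) \<otimes>\<^bsub>Z\<^esub> (gen y \<otimes>\<^bsub>Z\<^esub> ?u)"
      using that by (simp add: gen_relations)
    also have "\<dots> = ?u \<otimes>\<^bsub>Z\<^esub> ((gen x \<otimes>\<^bsub>Z\<^esub> gen y) \<otimes>\<^bsub>Z\<^esub> ?u)"
      using that by (simp add: Z.m_assoc)
    also have "\<dots> = ?u \<otimes>\<^bsub>Z\<^esub> ((gen y \<otimes>\<^bsub>Z\<^esub> gen x) \<otimes>\<^bsub>Z\<^esub> ?u)"
      using that by (simp add: gen_relations(1)[of x y])
    also have "\<dots> = ?u \<otimes>\<^bsub>Z\<^esub> gen y"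
      using that by (simp add: Z.m_assoc gen_relations(3))
    finally show ?thesis .
  qed
  then have "gen ` V \<subseteq> {p \<in> carrier Z. \<forall>s\<in>?S. p \<otimes>\<^bsub>Z\<^esub> s = s \<otimes>\<^bsub>Z\<^esub> p}"
    using gen_relations(1) by auto
  from Z_generated[OF Z.star_subalgebra_centralizer[OF S] this]
  have "gen ` V \<subseteq> {p \<in> carrier Z. \<forall>s\<in>carrier Z. p \<otimes>\<^bsub>Z\<^esub> s = s \<otimes>\<^bsub>Z\<^esub> p}"
    by (auto 0 4)
  from Z_generated[OF Z.star_subalgebra_centralizer this]
  have "p \<otimes>\<^bsub>Z\<^esub> s = s \<otimes>\<^bsub>Z\<^esub> p" if "p \<in> carrier Z" "s \<in> carrier Z" for p s
    using that by auto
  then show ?thesis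
    by (intro cring.intro Z.ring_axioms comm_monoid.intro Z.monoid_axioms comm_monoid_axioms.intro)
qed

text \<open>The values assigned to the generators are k-th roots of unity, so all relations vanish
  and evaluation descends from the free algebra.\<close>

lemma character_cyc_eval: "character Z (cyc_eval k \<phi>)"
  and cyc_eval_gen: "x \<in> V \<Longrightarrow> cyc_eval k \<phi> (gen x) = root_unity k ^ \<phi> x"
proof -
  interpret F: plain_star_algebra "free_star_algebra V" by (rule plain_F)
  interpret I: star_ideal "cyc_ideal k V" "free_star_algebra V" by (rule star_ideal_cyc)
  let ?e = "free_eval (\<lambda>x. root_unity k ^ \<phi> x)"
  have e: "character (free_star_algebra V) ?e" by (rule character_free_eval)
  have "(root_unity k ^ \<phi> x) ^ k = 1" for x
    using root_unity_power_k[OF k_pos] by (metis mult.commute power_mult power_one)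
  then have "?e r = 0" if "r \<in> cyc_relations k V" for r
    using that cnj_root_unity_mult[of k] cnj_root_unity_mult[of k, unfolded mult.commute[of "cnj _"]]
    by (auto simp: cyc_relations_def Let_def F.character_minus[OF e] F.character_pow[OF e]
        characterD[OF e] free_eval_gen)
  then have zero: "?e x = 0" if "x \<in> cyc_ideal k V" for x
    using F.character_star_idl[OF e cyc_relations_closed] that unfolding cyc_ideal_eq by blast
  show "character Z (cyc_eval k \<phi>)"
    unfolding cyc_algebra_def cyc_eval_def by (rule I.character_quot[OF e zero])
  show "x \<in> V \<Longrightarrow> cyc_eval k \<phi> (gen x) = root_unity k ^ \<phi> x"
    unfolding cyc_eval_def cyc_gen_def by (simp add: I.quot_character_coset[OF e zero] free_eval_gen)
qed

lemma spectral_proj_eq: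
  assumes "x \<in> V"
  shows "spectral_proj k V a x =
    plain_star_algebra.power_sum Z (gen x) k (\<lambda>n. 1 / of_nat k * inverse (root_unity k ^ (n * a)))"
proof -
  interpret Z: plain_star_algebra Z by (rule plain_Z)
  have "root_unity k powi (- (int n * int a)) = inverse (root_unity k ^ (n * a))" for n
    by (simp only: of_nat_mult[symmetric] power_int_minus power_int_of_nat)
  then show ?thesis
    using assms by (simp add: spectral_proj_def Z.power_sum_def[symmetric] Z.power_sum_smult)
qed

lemma spectral_proj_closed [simp]: "x \<in> V \<Longrightarrow> spectral_proj k V a x \<in> carrier Z"
  using plain_star_algebra.power_sum_closed[OF plain_Z] by (simp add: spectral_proj_eq)

text \<open>With omega the root of unity, the coefficients omega^(-na)/k satisfy the recursion of
  \<open>power_sum_eigenvector\<close> for r = omega^a, and they are periodic because omega^(ka) =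
  1.\<close>

lemma gen_mult_spectral_proj:
  assumes "x \<in> V"
  shows "gen x \<otimes>\<^bsub>Z\<^esub> spectral_proj k V a x = (root_unity k ^ a) \<odot>\<^bsub>Z\<^esub> spectral_proj k V a x"
proof -
  have "root_unity k ^ (k * a) = 1" by (simp add: power_mult root_unity_power_k k_pos)
  then show ?thesis
    unfolding spectral_proj_eq[OF assms] using assms
    by (intro plain_star_algebra.power_sum_eigenvector[OF plain_Z])
      (simp_all add: gen_relations power_add)
qed

text \<open>After exchanging the sums, the coefficient of x^n is the average of omega^(-na) over a:
  1 for n = 0 and 0 otherwise.\<close>

lemma sum_spectral_proj:
  assumes "x \<in> V"
  shows "(\<Oplus>\<^bsub>Z\<^esub>a\<in>{..<k}. spectral_proj k V a x) = \<one>\<^bsub>Z\<^esub>"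
proof -
  interpret Z: plain_star_algebra Z by (rule plain_Z)
  have "(\<Sum>a<k. 1 / of_nat k * inverse (root_unity k ^ (n * a))) = (if n = 0 then 1 else 0)"
    if "n < k" for n
    using root_unity_sum[OF that k_pos] by (simp add: power_mult divide_inverse power_inverse)
  then show ?thesis
    using assms k_pos
    by (simp add: spectral_proj_eq Z.power_sum_sum
        Z.power_sum_unit[OF gen_closed[OF assms] k_pos, symmetric] cong: Z.power_sum_cong)
qed

lemma cyc_eval_spectral_proj:
  assumes "x \<in> V" "a < k" "\<phi> x < k"
  shows "cyc_eval k \<phi> (spectral_proj k V a x) = (if a = \<phi> x then 1 else 0)"
proof -
  interpret Z: plain_star_algebra Z by (rule plain_Z)
  have "(root_unity k ^ \<phi> x / root_unity k ^ a) ^ n =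
      inverse (root_unity k ^ (n * a)) * (root_unity k ^ \<phi> x) ^ n" for n
    by (subst mult.commute[of n a]) (simp add: power_mult divide_inverse power_mult_distrib power_inverse)
  then show ?thesis
    using root_unity_sum[OF assms(2,3)] assms(1)
    by (simp add: spectral_proj_eq Z.character_power_sum[OF _ character_cyc_eval] cyc_eval_gen mult.assoc)
qed

lemma Phi_closed [simp]: "Phi k V \<phi> \<in> carrier Z"
proof -
  interpret Z: cring Z by (rule cring_Z)
  show ?thesis unfolding Phi_def by (intro Z.finprod_closed) auto
qed

lemma cyc_eval_finprod:
  assumes "finite W" "f \<in> W \<rightarrow> carrier Z"
  shows "cyc_eval k \<phi> (\<Otimes>\<^bsub>Z\<^esub>x\<in>W. f x) = (\<Prod>x\<in>W. cyc_eval k \<phi> (f x))"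
proof -
  interpret Z: cring Z by (rule cring_Z)
  show ?thesis
    using assms
    by (induction rule: finite_induct)
      (auto simp: characterD[OF character_cyc_eval] Z.finprod_closed)
qed

lemma cyc_eval_Phi:
  assumes "\<phi> \<in> V \<rightarrow>\<^sub>E {..<k}" "\<psi> \<in> V \<rightarrow>\<^sub>E {..<k}"
  shows "cyc_eval k \<phi> (Phi k V \<psi>) = (if \<phi> = \<psi> then 1 else 0)"
proof -
  have "cyc_eval k \<phi> (Phi k V \<psi>) = (\<Prod>x\<in>V. cyc_eval k \<phi> (spectral_proj k V (\<psi> x) x))"
    unfolding Phi_def using finite_V by (intro cyc_eval_finprod) auto
  also have "\<dots> = (\<Prod>x\<in>V. if \<psi> x = \<phi> x then 1 else 0)"
    using assms by (intro prod.cong cyc_eval_spectral_proj) auto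
  also have "\<dots> = (if \<phi> = \<psi> then 1 else 0)"
  proof (cases "\<phi> = \<psi>")
    case False
    then obtain x where "x \<in> V" "\<psi> x \<noteq> \<phi> x" using PiE_ext[OF assms] by metis
    then show ?thesis using finite_V False by (auto intro!: prod_zero)
  qed simp
  finally show ?thesis .
qed

text \<open>A generator acts by a scalar on its own spectral projection, and commutativity brings
  that factor to the front of the product. Unitarity gives the adjoints, and
  \<open>star_subalgebra_eigenspace\<close> extends the claim to all elements.\<close>

lemma mult_Phi:
  assumes p: "p \<in> carrier Z"
  shows "p \<otimes>\<^bsub>Z\<^esub> Phi k V \<phi> = cyc_eval k \<phi> p \<odot>\<^bsub>Z\<^esub> Phi k V \<phi>"
proof -
  interpret Z: plain_star_algebra Z by (rule plain_Z)
  interpret Z: cring Z by (rule cring_Z)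
  let ?P = "Phi k V \<phi>" and ?w = "\<lambda>x. root_unity k ^ \<phi> x"
  have gen: "gen x \<otimes>\<^bsub>Z\<^esub> ?P = ?w x \<odot>\<^bsub>Z\<^esub> ?P" if x: "x \<in> V" for x
  proof -
    let ?R = "\<Otimes>\<^bsub>Z\<^esub>y\<in>V - {x}. spectral_proj k V (\<phi> y) y"
    have "(\<Otimes>\<^bsub>Z\<^esub>y\<in>insert x (V - {x}). spectral_proj k V (\<phi> y) y) = spectral_proj k V (\<phi> x) x \<otimes>\<^bsub>Z\<^esub> ?R"
      using finite_V x by (intro Z.finprod_insert) auto
    moreover have "insert x (V - {x}) = V" using x by auto
    ultimately have "?P = spectral_proj k V (\<phi> x) x \<otimes>\<^bsub>Z\<^esub> ?R" by (simp add: Phi_def)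
    moreover have "?R \<in> carrier Z" by (intro Z.finprod_closed) auto
    ultimately show ?thesis
      using x gen_mult_spectral_proj[OF x]
      by (simp add: Z.smult_mult_left flip: Z.m_assoc)
  qed
  have adj_gen: "adj Z (gen x) \<otimes>\<^bsub>Z\<^esub> ?P = cnj (?w x) \<odot>\<^bsub>Z\<^esub> ?P" if x: "x \<in> V" for x
  proof -
    \<comment> \<open>Insert 1 as the conjugate of the eigenvalue times the eigenvalue; the latter
      turns back into the generator, which its adjoint then cancels.\<close>
    have "adj Z (gen x) \<otimes>\<^bsub>Z\<^esub> ?P = adj Z (gen x) \<otimes>\<^bsub>Z\<^esub> ((cnj (?w x) * ?w x) \<odot>\<^bsub>Z\<^esub> ?P)"
      by (simp only: cnj_root_unity_mult Z.smult_one Phi_closed)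
    also have "\<dots> = cnj (?w x) \<odot>\<^bsub>Z\<^esub> (adj Z (gen x) \<otimes>\<^bsub>Z\<^esub> (?w x \<odot>\<^bsub>Z\<^esub> ?P))"
      using x by (simp add: Z.smult_mult_right Z.smult_smult)
    also have "\<dots> = cnj (?w x) \<odot>\<^bsub>Z\<^esub> ((adj Z (gen x) \<otimes>\<^bsub>Z\<^esub> gen x) \<otimes>\<^bsub>Z\<^esub> ?P)"
      using x by (simp add: Z.m_assoc flip: gen)
    finally show ?thesis using x by (simp add: gen_relations(2))
  qed
  let ?E = "{p \<in> carrier Z. p \<otimes>\<^bsub>Z\<^esub> ?P = cyc_eval k \<phi> p \<odot>\<^bsub>Z\<^esub> ?P \<and>
      adj Z p \<otimes>\<^bsub>Z\<^esub> ?P = cnj (cyc_eval k \<phi> p) \<odot>\<^bsub>Z\<^esub> ?P}"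
  have "?E = carrier Z"
    by (rule Z_generated[OF Z.star_subalgebra_eigenspace[OF character_cyc_eval Phi_closed]])
      (use gen adj_gen in \<open>auto simp: cyc_eval_gen\<close>)
  then show ?thesis using p by blast
qed

text \<open>The projections \<^const>\<open>Phi\<close> resolve the unit. To avoid expanding a product of sums, this is
  stated as a membership test for ideals, proved by adding one variable at a time.\<close>

lemma ideal_mem_if_mult_Phi_mem:
  assumes J: "ideal J Z" and p: "p \<in> carrier Z"
    and mem: "\<And>\<phi>. \<phi> \<in> V \<rightarrow>\<^sub>E {..<k} \<Longrightarrow> p \<otimes>\<^bsub>Z\<^esub> Phi k V \<phi> \<in> J"
  shows "p \<in> J"
proof -
  interpret Z: plain_star_algebra Z by (rule plain_Z)
  interpret Z: cring Z by (rule cring_Z)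
  interpret J: ideal J Z by (rule J)
  let ?pr = "\<lambda>W \<phi>. \<Otimes>\<^bsub>Z\<^esub>x\<in>W. spectral_proj k V (\<phi> x) x"
  have finsum_mem: "(\<Oplus>\<^bsub>Z\<^esub>i\<in>B. f i) \<in> J" if "finite B" "f \<in> B \<rightarrow> J" for B :: "nat set" and f
    using that
  proof (induction rule: finite_induct)
    case (insert i B)
    then have "f \<in> B \<rightarrow> carrier Z" "f i \<in> carrier Z" using J.a_subset by auto
    then show ?case using insert by simp
  qed simp
  \<comment> \<open>The hypothesis ranges over functions bounded on \<open>W\<close> rather than
    extensional ones, so that the value at a new variable can be set by an update.\<close>
  have "p \<in> J" if "finite W" "W \<subseteq> V" "\<And>\<phi>. (\<And>x. x \<in> W \<Longrightarrow> \<phi> x < k) \<Longrightarrow> p \<otimes>\<^bsub>Z\<^esub> ?pr W \<phi> \<in> J" for W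
    using that
  proof (induction W rule: finite_induct)
    case empty
    then show ?case using p by simp
  next
    case (insert y W)
    have y: "y \<in> V" and W: "W \<subseteq> V" using insert by auto
    have "p \<otimes>\<^bsub>Z\<^esub> ?pr W \<phi> \<in> J" if \<phi>: "\<And>x. x \<in> W \<Longrightarrow> \<phi> x < k" for \<phi>
    proof -
      have R: "?pr W \<phi> \<in> carrier Z" using W by (intro Z.finprod_closed) auto
      have "p \<otimes>\<^bsub>Z\<^esub> (spectral_proj k V a y \<otimes>\<^bsub>Z\<^esub> ?pr W \<phi>) \<in> J" if "a < k" for a
      proof -
        have "?pr (insert y W) (\<phi>(y := a)) =
            spectral_proj k V a y \<otimes>\<^bsub>Z\<^esub> ?pr W (\<phi>(y := a))"
          using insert.hyps W y by (subst Z.finprod_insert) auto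
        also have "?pr W (\<phi>(y := a)) = ?pr W \<phi>"
          using insert.hyps W by (intro Z.finprod_cong') auto
        finally have eq: "?pr (insert y W) (\<phi>(y := a)) = spectral_proj k V a y \<otimes>\<^bsub>Z\<^esub> ?pr W \<phi>" .
        have "(\<phi>(y := a)) x < k" if "x \<in> insert y W" for x
          using \<phi> \<open>a < k\<close> that by auto
        from insert.prems(2)[of "\<phi>(y := a)", OF this] show ?thesis unfolding eq .
      qed
      \<comment> \<open>Summing over all values at \<open>y\<close> turns the factor for
        \<open>y\<close> into the unit.\<close>
      then have "(\<Oplus>\<^bsub>Z\<^esub>a\<in>{..<k}. p \<otimes>\<^bsub>Z\<^esub> (spectral_proj k V a y \<otimes>\<^bsub>Z\<^esub> ?pr W \<phi>)) \<in> J"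
        by (intro finsum_mem) auto
      also have "(\<Oplus>\<^bsub>Z\<^esub>a\<in>{..<k}. p \<otimes>\<^bsub>Z\<^esub> (spectral_proj k V a y \<otimes>\<^bsub>Z\<^esub> ?pr W \<phi>)) =
          p \<otimes>\<^bsub>Z\<^esub> ((\<Oplus>\<^bsub>Z\<^esub>a\<in>{..<k}. spectral_proj k V a y) \<otimes>\<^bsub>Z\<^esub> ?pr W \<phi>)"
        using p R y by (simp add: Z.finsum_ldistr Z.finsum_rdistr Pi_def)
      finally show ?thesis using R by (simp add: sum_spectral_proj[OF y])
    qed
    then show ?case by (rule insert.IH[OF W])
  qed
  moreover have "p \<otimes>\<^bsub>Z\<^esub> ?pr V \<phi> \<in> J" if "\<And>x. x \<in> V \<Longrightarrow> \<phi> x < k" for \<phi>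
  proof -
    \<comment> \<open>The product sees only values on \<open>V\<close>, so restriction leads to an
      assignment covered by \<open>mem\<close>.\<close>
    have "Phi k V (restrict \<phi> V) = ?pr V \<phi>"
      unfolding Phi_def by (intro Z.finprod_cong') auto
    moreover have "restrict \<phi> V \<in> V \<rightarrow>\<^sub>E {..<k}" using that by auto
    ultimately show ?thesis using mem by metis
  qed
  ultimately show ?thesis using finite_V by blast
qed

text \<open>Separation is the point: if the values of \<open>p\<close> on \<open>C\<close> vanish,
  then \<open>p\<close> times \<open>Phi k V \<phi>\<close> is 0 for \<open>\<phi>\<close> in
  \<open>C\<close>, and it lies in the ideal for the other \<open>\<phi>\<close>, whose
  \<open>Phi\<close> generate that ideal. So \<open>p\<close> itself lies in it.\<close>

lemma coordinates_constraint_algebra: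
  assumes C: "C \<subseteq> V \<rightarrow>\<^sub>E {..<k}"
  shows "coordinates (constraint_algebra k V C) C
    (\<lambda>\<phi>. constraint_ideal k V C +>\<^bsub>Z\<^esub> Phi k V \<phi>) (\<lambda>\<phi>. quot_character (cyc_eval k \<phi>))"
proof -
  interpret Z: plain_star_algebra Z by (rule plain_Z)
  let ?R = "{Phi k V \<phi> |\<phi>. \<phi> \<in> (V \<rightarrow>\<^sub>E {..<k}) \<and> \<phi> \<notin> C}"
  have R: "?R \<subseteq> carrier Z" by auto
  interpret J: star_ideal "constraint_ideal k V C" Z
    unfolding constraint_ideal_def by (rule Z.star_ideal_star_idl[OF R])
  have R_J: "?R \<subseteq> constraint_ideal k V C"
    unfolding constraint_ideal_def by (rule Z.star_ideal_star_idl[OF R])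
  have zero: "cyc_eval k \<phi> x = 0" if "\<phi> \<in> C" "x \<in> constraint_ideal k V C" for \<phi> x
    by (rule Z.character_star_idl[OF character_cyc_eval R])
      (use that C in \<open>auto simp: constraint_ideal_def cyc_eval_Phi subset_iff\<close>)
  interpret CA: plain_star_algebra "constraint_algebra k V C"
    unfolding constraint_algebra_def by (rule J.plain_star_algebra_quot)
  note coset = J.quot_character_coset[OF character_cyc_eval zero]
  show ?thesis
  proof
    show "finite C"
      by (rule finite_subset[OF C]) (simp add: finite_PiE finite_V)
    show "character (constraint_algebra k V C) (quot_character (cyc_eval k \<phi>))" if "\<phi> \<in> C" for \<phi>
      unfolding constraint_algebra_def by (rule J.character_quot[OF character_cyc_eval zero[OF that]])
    show "constraint_ideal k V C +>\<^bsub>Z\<^esub> Phi k V \<phi> \<in> carrier (constraint_algebra k V C)" for \<phi>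
      unfolding constraint_algebra_def by (simp add: J.quot_simps)
    show "quot_character (cyc_eval k \<phi>) (constraint_ideal k V C +>\<^bsub>Z\<^esub> Phi k V \<psi>) =
        (if \<phi> = \<psi> then 1 else 0)" if "\<phi> \<in> C" "\<psi> \<in> C" for \<phi> \<psi>
      using that C by (simp add: coset cyc_eval_Phi subset_iff)
    show "Y = \<zero>\<^bsub>constraint_algebra k V C\<^esub>"
      if Y: "Y \<in> carrier (constraint_algebra k V C)"
        and ev: "\<And>\<phi>. \<phi> \<in> C \<Longrightarrow> quot_character (cyc_eval k \<phi>) Y = 0" for Y
    proof -
      obtain p where p: "p \<in> carrier Z" "Y = constraint_ideal k V C +>\<^bsub>Z\<^esub> p"
        using Y by (auto simp: constraint_algebra_def J.quot_simps)
      have "p \<otimes>\<^bsub>Z\<^esub> Phi k V \<phi> \<in> constraint_ideal k V C" if "\<phi> \<in> V \<rightarrow>\<^sub>E {..<k}" for \<phi>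
      proof (cases "\<phi> \<in> C")
        case True
        then show ?thesis using ev[OF True] p by (simp add: coset mult_Phi)
      next
        case False
        then show ?thesis using that R_J p by (intro J.I_l_closed) auto
      qed
      then have "p \<in> constraint_ideal k V C"
        by (intro ideal_mem_if_mult_Phi_mem[OF J.is_ideal p(1)])
      then show ?thesis
        using p Z.a_rcos_zero[OF J.is_ideal] by (simp add: constraint_algebra_def J.quot_simps)
    qed
  qed
qed

end

section \<open>Functoriality of the free product\<close>

text \<open>Substitution of letters along a bijection: elements are functions on words, so it is
  precomposition with the inverse \<open>\<sigma>\<close>. The zero branch keeps the result
  supported on words over \<open>H\<close>, outside of which \<open>\<sigma>\<close> is
  arbitrary.\<close>

definition relabel :: "'h set \<Rightarrow> ('h \<Rightarrow> 'g) \<Rightarrow> 'g free_elem \<Rightarrow> 'h free_elem" where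
  "relabel H \<sigma> p = (\<lambda>w. if set w \<subseteq> H \<times> UNIV then p (map (apfst \<sigma>) w) else 0)"

locale relabelling =
  fixes G :: "'g set" and H :: "'h set" and \<rho> :: "'g \<Rightarrow> 'h" and \<sigma> :: "'h \<Rightarrow> 'g"
  assumes \<rho>: "g \<in> G \<Longrightarrow> \<rho> g \<in> H" and \<sigma>: "h \<in> H \<Longrightarrow> \<sigma> h \<in> G"
    and \<sigma>_\<rho>: "g \<in> G \<Longrightarrow> \<sigma> (\<rho> g) = g" and \<rho>_\<sigma>: "h \<in> H \<Longrightarrow> \<rho> (\<sigma> h) = h"
begin

lemma sym: "relabelling H G \<sigma> \<rho>"
  by unfold_locales (simp_all add: \<rho> \<sigma> \<sigma>_\<rho> \<rho>_\<sigma>)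

lemma map_\<rho>_\<sigma>: "set w \<subseteq> H \<times> UNIV \<Longrightarrow> map (apfst \<rho>) (map (apfst \<sigma>) w) = w"
  by (induction w) (auto simp: \<rho>_\<sigma>)

lemma map_\<sigma>_closed: "set w \<subseteq> H \<times> UNIV \<Longrightarrow> set (map (apfst \<sigma>) w) \<subseteq> G \<times> UNIV"
  by (auto simp: \<sigma>)

lemma relabel_closed:
  assumes "p \<in> carrier (free_star_algebra G)"
  shows "relabel H \<sigma> p \<in> carrier (free_star_algebra H)"
proof -
  have "{w. relabel H \<sigma> p w \<noteq> 0} \<subseteq> map (apfst \<rho>) ` {w. p w \<noteq> 0}"
  proof
    fix w assume "w \<in> {w. relabel H \<sigma> p w \<noteq> 0}"
    then have "set w \<subseteq> H \<times> UNIV" "p (map (apfst \<sigma>) w) \<noteq> 0"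
      by (auto simp: relabel_def split: if_splits)
    then show "w \<in> map (apfst \<rho>) ` {w. p w \<noteq> 0}"
      by (intro image_eqI[of _ _ "map (apfst \<sigma>) w"]) (simp_all only: map_\<rho>_\<sigma> mem_Collect_eq, simp)
  qed
  then have "finite {w. relabel H \<sigma> p w \<noteq> 0}"
    by (rule finite_subset) (use assms in \<open>simp add: free_star_algebra_carrier_iff\<close>)
  then show ?thesis
    by (auto simp: free_star_algebra_carrier_iff relabel_def split: if_splits)
qed

lemma relabel_relabel:
  assumes "q \<in> carrier (free_star_algebra H)"
  shows "relabel H \<sigma> (relabel G \<rho> q) = q"
proof
  fix w
  show "relabel H \<sigma> (relabel G \<rho> q) w = q w"
  proof (cases "set w \<subseteq> H \<times> UNIV")
    case True
    then show ?thesis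
      unfolding relabel_def using map_\<rho>_\<sigma>[OF True] map_\<sigma>_closed[OF True] by (simp del: map_map)
  next
    case False
    then have "q w = 0" using assms by (auto simp: free_star_algebra_carrier_iff)
    with False show ?thesis by (simp add: relabel_def)
  qed
qed

text \<open>A word lies over \<open>H\<close> exactly when both pieces of a cut do, so truncation to
  such words respects every cut.\<close>

lemma relabel_conv: "relabel H \<sigma> (conv p q) = conv (relabel H \<sigma> p) (relabel H \<sigma> q)"
proof
  fix w
  show "relabel H \<sigma> (conv p q) w = conv (relabel H \<sigma> p) (relabel H \<sigma> q) w"
  proof (cases "set w \<subseteq> H \<times> UNIV")
    case True
    then have "set (take i w) \<subseteq> H \<times> UNIV" "set (drop i w) \<subseteq> H \<times> UNIV" for i
      using set_take_subset[of i w] set_drop_subset[of i w] by auto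
    with True show ?thesis by (simp add: relabel_def conv_def take_map drop_map)
  next
    case False
    have "relabel H \<sigma> p (take i w) * relabel H \<sigma> q (drop i w) = 0" for i
    proof -
      have "set w = set (take i w) \<union> set (drop i w)"
        by (metis append_take_drop_id set_append)
      then show ?thesis using False by (auto simp: relabel_def)
    qed
    then have "conv (relabel H \<sigma> p) (relabel H \<sigma> q) w = 0"
      unfolding conv_def by (intro sum.neutral) blast
    with False show ?thesis by (simp add: relabel_def)
  qed
qed

lemma relabel_star_iso: "relabel H \<sigma> \<in> star_iso (free_star_algebra G) (free_star_algebra H)"
proof -
  have "bij_betw (relabel H \<sigma>) (carrier (free_star_algebra G)) (carrier (free_star_algebra H))"
    using relabel_closed relabelling.relabel_closed[OF sym]
      relabel_relabel relabelling.relabel_relabel[OF sym]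
    by (intro bij_betw_byWitness[where f' = "relabel G \<rho>"]) auto
  moreover have "relabel H \<sigma> \<in> star_hom (free_star_algebra G) (free_star_algebra H)"
  proof (rule star_homI)
    fix p assume "p \<in> carrier (free_star_algebra G)"
    have "set (flip_word w) \<subseteq> H \<times> UNIV \<longleftrightarrow> set w \<subseteq> H \<times> UNIV" for w :: "('h \<times> bool) list"
      by (force simp: apsnd_def map_prod_def)
    then show "relabel H \<sigma> (adj (free_star_algebra G) p) = adj (free_star_algebra H) (relabel H \<sigma> p)"
      by (simp add: free_star_algebra_simps relabel_def fun_eq_iff rev_map comp_def apsnd_apfst_commute)
  qed (auto simp: relabel_closed free_star_algebra_simps relabel_conv, auto simp: relabel_def fun_eq_iff)
  ultimately show ?thesis by (simp add: star_iso_def)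
qed

lemma relabel_free_gen: "g \<in> G \<Longrightarrow> relabel H \<sigma> (free_gen g) = free_gen (\<rho> g)"
  by (auto simp: relabel_def free_gen_def fun_eq_iff map_eq_Cons_conv apfst_def map_prod_def
      \<rho> \<sigma>_\<rho> \<rho>_\<sigma> split: prod.splits)

end

section \<open>Presentations of free products\<close>

definition free_product_relations :: "'i set \<Rightarrow> ('i \<Rightarrow> 'a star_alg) \<Rightarrow> ('i \<times> 'a) free_elem set" where
  "free_product_relations I A =
    (let F = free_star_algebra (SIGMA i:I. carrier (A i)); g = (\<lambda>i a. free_gen (i, a)) in
      {(g i a \<oplus>\<^bsub>F\<^esub> g i b) \<ominus>\<^bsub>F\<^esub> g i (a \<oplus>\<^bsub>A i\<^esub> b) |i a b.
          i \<in> I \<and> a \<in> carrier (A i) \<and> b \<in> carrier (A i)} \<union>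
       {(g i a \<otimes>\<^bsub>F\<^esub> g i b) \<ominus>\<^bsub>F\<^esub> g i (a \<otimes>\<^bsub>A i\<^esub> b) |i a b.
          i \<in> I \<and> a \<in> carrier (A i) \<and> b \<in> carrier (A i)} \<union>
       {(c \<odot>\<^bsub>F\<^esub> g i a) \<ominus>\<^bsub>F\<^esub> g i (c \<odot>\<^bsub>A i\<^esub> a) |i c a. i \<in> I \<and> a \<in> carrier (A i)} \<union>
       {adj F (g i a) \<ominus>\<^bsub>F\<^esub> g i (adj (A i) a) |i a. i \<in> I \<and> a \<in> carrier (A i)} \<union>
       {g i \<one>\<^bsub>A i\<^esub> \<ominus>\<^bsub>F\<^esub> \<one>\<^bsub>F\<^esub> |i. i \<in> I})"

lemma free_product_relationsI:
  fixes A :: "'i \<Rightarrow> 'a star_alg" and I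
  defines "F \<equiv> free_star_algebra (SIGMA i:I. carrier (A i))" and "g \<equiv> \<lambda>i a. free_gen (i, a)"
  assumes "i \<in> I" "a \<in> carrier (A i)"
  shows "b \<in> carrier (A i) \<Longrightarrow>
      (g i a \<oplus>\<^bsub>F\<^esub> g i b) \<ominus>\<^bsub>F\<^esub> g i (a \<oplus>\<^bsub>A i\<^esub> b) \<in> free_product_relations I A"
    and "b \<in> carrier (A i) \<Longrightarrow>
      (g i a \<otimes>\<^bsub>F\<^esub> g i b) \<ominus>\<^bsub>F\<^esub> g i (a \<otimes>\<^bsub>A i\<^esub> b) \<in> free_product_relations I A"
    and "(c \<odot>\<^bsub>F\<^esub> g i a) \<ominus>\<^bsub>F\<^esub> g i (c \<odot>\<^bsub>A i\<^esub> a) \<in> free_product_relations I A"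
    and "adj F (g i a) \<ominus>\<^bsub>F\<^esub> g i (adj (A i) a) \<in> free_product_relations I A"
    and "g i \<one>\<^bsub>A i\<^esub> \<ominus>\<^bsub>F\<^esub> \<one>\<^bsub>F\<^esub> \<in> free_product_relations I A"
  using assms(3,4) unfolding free_product_relations_def Let_def F_def g_def by blast+

lemma free_product_ideal_eq:
  "free_product_ideal I A =
     star_idl (free_star_algebra (SIGMA i:I. carrier (A i))) (free_product_relations I A)"
  by (simp add: free_product_ideal_def free_product_relations_def Let_def)

context
  fixes I :: "'i set" and A :: "'i \<Rightarrow> 'a star_alg"
  assumes plain: "\<And>i. i \<in> I \<Longrightarrow> plain_star_algebra (A i)"
begin

lemma component_closed:
  assumes "i \<in> I"
  shows "\<lbrakk>a \<in> carrier (A i); b \<in> carrier (A i)\<rbrakk> \<Longrightarrow> a \<oplus>\<^bsub>A i\<^esub> b \<in> carrier (A i)"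
    and "\<lbrakk>a \<in> carrier (A i); b \<in> carrier (A i)\<rbrakk> \<Longrightarrow> a \<otimes>\<^bsub>A i\<^esub> b \<in> carrier (A i)"
    and "a \<in> carrier (A i) \<Longrightarrow> c \<odot>\<^bsub>A i\<^esub> a \<in> carrier (A i)"
    and "a \<in> carrier (A i) \<Longrightarrow> adj (A i) a \<in> carrier (A i)"
    and "\<one>\<^bsub>A i\<^esub> \<in> carrier (A i)"
proof -
  interpret plain_star_algebra "A i" by (rule plain[OF assms])
  show "\<lbrakk>a \<in> carrier (A i); b \<in> carrier (A i)\<rbrakk> \<Longrightarrow> a \<oplus>\<^bsub>A i\<^esub> b \<in> carrier (A i)"
    "\<lbrakk>a \<in> carrier (A i); b \<in> carrier (A i)\<rbrakk> \<Longrightarrow> a \<otimes>\<^bsub>A i\<^esub> b \<in> carrier (A i)"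
    "a \<in> carrier (A i) \<Longrightarrow> c \<odot>\<^bsub>A i\<^esub> a \<in> carrier (A i)"
    "a \<in> carrier (A i) \<Longrightarrow> adj (A i) a \<in> carrier (A i)"
    "\<one>\<^bsub>A i\<^esub> \<in> carrier (A i)"
    by simp_all
qed

lemma free_product_relations_closed:
  "free_product_relations I A \<subseteq> carrier (free_star_algebra (SIGMA i:I. carrier (A i)))"
proof -
  interpret F: plain_star_algebra "free_star_algebra (SIGMA i:I. carrier (A i))"
    by (rule plain_star_algebra_free)
  show ?thesis
    unfolding free_product_relations_def Let_def
    by (auto intro!: F.minus_closed F.add.m_closed F.m_closed F.smult_closed F.adj_closed
        free_gen_closed component_closed)
qed

lemma star_ideal_free_product:
  "star_ideal (free_product_ideal I A) (free_star_algebra (SIGMA i:I. carrier (A i)))"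
  unfolding free_product_ideal_eq
  by (rule plain_star_algebra.star_ideal_star_idl[OF plain_star_algebra_free
        free_product_relations_closed])

lemma plain_star_algebra_free_product: "plain_star_algebra (free_product I A)"
  unfolding free_product_def by (rule star_ideal.plain_star_algebra_quot[OF star_ideal_free_product])

lemma free_product_inj_closed:
  "\<lbrakk>i \<in> I; a \<in> carrier (A i)\<rbrakk> \<Longrightarrow> free_product_inj I A i a \<in> carrier (free_product I A)"
  using star_ideal.quot_simps(1)[OF star_ideal_free_product]
  by (simp add: free_product_def free_product_inj_def)

end

text \<open>Each relation records one operation of one component, and \<open>h i\<close> preserves
  that operation, so renaming yields a relation of the same kind over \<open>B\<close>.\<close>

lemma relabel_free_product_relations:
  fixes A :: "'i \<Rightarrow> 'a star_alg" and B :: "'i \<Rightarrow> 'b star_alg"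
  assumes A: "\<And>i. i \<in> I \<Longrightarrow> plain_star_algebra (A i)"
    and h: "\<And>i. i \<in> I \<Longrightarrow> h i \<in> star_hom (A i) (B i)"
    and rel: "relabelling (SIGMA i:I. carrier (A i)) (SIGMA i:I. carrier (B i)) (\<lambda>(i, a). (i, h i a)) \<sigma>"
  shows "relabel (SIGMA i:I. carrier (B i)) \<sigma> ` free_product_relations I A \<subseteq> free_product_relations I B"
proof -
  let ?G = "SIGMA i:I. carrier (A i)" and ?H = "SIGMA i:I. carrier (B i)"
  interpret F: plain_star_algebra "free_star_algebra ?G" by (rule plain_star_algebra_free)
  interpret relabelling ?G ?H "\<lambda>(i, a). (i, h i a)" \<sigma> by (rule rel)
  note r = star_isoD(1)[OF relabel_star_iso]
  note minus = star_hom_minus[OF plain_star_algebra_free plain_star_algebra_free r]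
  note simps = minus star_homD[OF r] relabel_free_gen component_closed[of I A, OF A]
  note hom = star_homD[OF h]
  show ?thesis
  proof (rule image_subsetI)
    fix r assume "r \<in> free_product_relations I A"
    then show "relabel ?H \<sigma> r \<in> free_product_relations I B"
      unfolding free_product_relations_def[of I A] Let_def
    proof (elim UnE CollectE exE conjE)
      fix i assume "i \<in> I" "r = free_gen (i, \<one>\<^bsub>A i\<^esub>) \<ominus>\<^bsub>free_star_algebra ?G\<^esub> \<one>\<^bsub>free_star_algebra ?G\<^esub>"
      note i = this
      \<comment> \<open>The unit relation mentions no further element, but its introduction rule
        asks for one in the carrier; the image of the unit serves.\<close>
      have one: "\<one>\<^bsub>A i\<^esub> \<in> carrier (A i)" by (rule component_closed(5)[of I A, OF A i(1)])
      have "relabel ?H \<sigma> r = free_gen (i, \<one>\<^bsub>B i\<^esub>) \<ominus>\<^bsub>free_star_algebra ?H\<^esub> \<one>\<^bsub>free_star_algebra ?H\<^esub>"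
        unfolding i(2) using i(1) one by (simp add: minus star_homD(1)[OF r] relabel_free_gen hom(1))
      also have "\<dots> \<in> free_product_relations I B"
        using free_product_relationsI(5)[of i I _ B, OF i(1) hom(2)[OF i(1) one]] .
      finally show ?thesis .
    qed (simp_all add: simps hom free_product_relationsI)
  qed
qed

text \<open>Bijections between components are bijections between generators. The relations
  correspond in both directions, hence so do the ideals.\<close>

lemma free_product_iso:
  fixes A :: "'i \<Rightarrow> 'a star_alg" and B :: "'i \<Rightarrow> 'b star_alg"
  assumes A: "\<And>i. i \<in> I \<Longrightarrow> plain_star_algebra (A i)"
    and B: "\<And>i. i \<in> I \<Longrightarrow> plain_star_algebra (B i)"
    and h: "\<And>i. i \<in> I \<Longrightarrow> h i \<in> star_iso (A i) (B i)"
  obtains \<alpha> where "\<alpha> \<in> star_iso (free_product I A) (free_product I B)"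
    and "\<And>i a. \<lbrakk>i \<in> I; a \<in> carrier (A i)\<rbrakk> \<Longrightarrow>
      \<alpha> (free_product_inj I A i a) = free_product_inj I B i (h i a)"
proof -
  let ?G = "SIGMA i:I. carrier (A i)" and ?H = "SIGMA i:I. carrier (B i)"
  define g where "g i = inv_into (carrier (A i)) (h i)" for i
  let ?\<rho> = "\<lambda>(i, a). (i, h i a)" and ?\<sigma> = "\<lambda>(i, b). (i, g i b)"
  have g: "g i \<in> star_iso (B i) (A i)" if "i \<in> I" for i
    unfolding g_def by (rule star_iso_inv[OF A[OF that] B[OF that] h[OF that]])
  have gh: "g i (h i a) = a" if "i \<in> I" "a \<in> carrier (A i)" for i a
    using star_isoD[OF h[OF that(1)]] that(2) by (simp add: g_def)
  have hg: "h i (g i b) = b" if "i \<in> I" "b \<in> carrier (B i)" for i b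
    using star_isoD[OF h[OF that(1)]] that(2) by (simp add: g_def f_inv_into_f)
  have closed: "h i a \<in> carrier (B i)" "g i b \<in> carrier (A i)"
    if "i \<in> I" "a \<in> carrier (A i)" "b \<in> carrier (B i)" for i a b
    using star_homD(2)[OF star_isoD(1)[OF h]] star_homD(2)[OF star_isoD(1)[OF g]] that by auto
  interpret R: relabelling ?G ?H ?\<rho> ?\<sigma>
    using star_homD(2)[OF star_isoD(1)[OF h]] star_homD(2)[OF star_isoD(1)[OF g]]
    by unfold_locales (auto simp: gh hg)
  let ?r = "relabel ?H ?\<sigma>"
  \<comment> \<open>For the reverse inclusion, relations over \<open>B\<close> are renamed along the
    inverses and back again.\<close>
  have "free_product_relations I B = ?r ` relabel ?G ?\<rho> ` free_product_relations I B"
    using R.relabel_relabel subsetD[OF free_product_relations_closed[OF B]]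
    by (force simp: image_image)
  also have "\<dots> \<subseteq> ?r ` free_product_relations I A"
    by (rule image_mono[OF relabel_free_product_relations[OF B star_isoD(1)[OF g] R.sym]])
  finally have rels: "?r ` free_product_relations I A = free_product_relations I B"
    using relabel_free_product_relations[OF A star_isoD(1)[OF h] R.relabelling_axioms] by blast
  note iso = star_quot_iso[OF plain_star_algebra_free plain_star_algebra_free R.relabel_star_iso
      free_product_relations_closed[OF A]]
  show thesis
  proof (rule that)
    show "image ?r \<in> star_iso (free_product I A) (free_product I B)"
      using iso(1) unfolding rels free_product_def free_product_ideal_eq .
    show "?r ` free_product_inj I A i a = free_product_inj I B i (h i a)"
      if "i \<in> I" "a \<in> carrier (A i)" for i a
      using iso(2)[of "free_gen (i, a)"] that
      unfolding rels free_product_inj_def free_product_ideal_eq by (simp add: R.relabel_free_gen)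
  qed
qed

section \<open>The boolean form\<close>

lemma bool_assignment_apply:
  "\<lbrakk>x \<in> V; a < k\<rbrakk> \<Longrightarrow> bool_assignment k V \<phi> (x, a) = (if \<phi> x = a then 1 else 0)"
  by (simp add: bool_assignment_def)

text \<open>The boolean assignments are compared at \<open>(x, \<phi> x)\<close>, a point of the
  domain because \<open>\<phi> x < k\<close>: the value 1 for \<open>\<phi>\<close> forces
  \<open>\<psi> x = \<phi> x\<close>. Taking all three sets equal yields injectivity.\<close>

lemma bool_assignment_restrict_eq_iff:
  assumes "\<phi> \<in> V \<rightarrow>\<^sub>E {..<k}" "\<psi> \<in> W \<rightarrow>\<^sub>E {..<k}" "U \<subseteq> V \<inter> W"
  shows "restrict (bool_assignment k V \<phi>) (U \<times> {..<k}) = restrict (bool_assignment k W \<psi>) (U \<times> {..<k}) \<longleftrightarrow>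
    restrict \<phi> U = restrict \<psi> U"
proof
  assume eq: "restrict (bool_assignment k V \<phi>) (U \<times> {..<k}) = restrict (bool_assignment k W \<psi>) (U \<times> {..<k})"
  show "restrict \<phi> U = restrict \<psi> U"
  proof (rule restrict_ext)
    fix x assume x: "x \<in> U"
    then have "\<phi> x < k" "x \<in> V" "x \<in> W" using assms by auto
    then show "\<phi> x = \<psi> x"
      using fun_cong[OF eq, of "(x, \<phi> x)"] x by (simp add: bool_assignment_apply split: if_splits)
  qed
next
  assume eq: "restrict \<phi> U = restrict \<psi> U"
  show "restrict (bool_assignment k V \<phi>) (U \<times> {..<k}) = restrict (bool_assignment k W \<psi>) (U \<times> {..<k})"
  proof (rule restrict_ext)
    fix z assume "z \<in> U \<times> {..<k}"
    then obtain x a where z: "z = (x, a)" "x \<in> U" "a < k" by auto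
    then have "x \<in> V" "x \<in> W" "\<phi> x = \<psi> x" using assms(3) fun_cong[OF eq, of x] by auto
    then show "bool_assignment k V \<phi> z = bool_assignment k W \<psi> z"
      using z by (simp add: bool_assignment_apply)
  qed
qed

lemma inj_on_bool_assignment: "inj_on (bool_assignment k V) (V \<rightarrow>\<^sub>E {..<k})"
proof (rule inj_onI)
  fix \<phi> \<psi> assume *: "\<phi> \<in> V \<rightarrow>\<^sub>E {..<k}" "\<psi> \<in> V \<rightarrow>\<^sub>E {..<k}"
    "bool_assignment k V \<phi> = bool_assignment k V \<psi>"
  then show "\<phi> = \<psi>"
    using bool_assignment_restrict_eq_iff[OF *(1,2), of V] by (simp add: PiE_restrict)
qed

section \<open>Conflicts and weights of one constraint system\<close>

lemma constraint_systemD: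
  assumes "constraint_system k S" "i < num_constraints S"
  shows "finite (scope S i)" "allowed S i \<subseteq> scope S i \<rightarrow>\<^sub>E {..<k}"
proof -
  have "constraints S ! i \<in> set (constraints S)" using assms(2) by simp
  then have "scope S i \<subseteq> variables S \<and> allowed S i \<subseteq> scope S i \<rightarrow>\<^sub>E {..<k}"
    using assms(1) unfolding constraint_system_def by (metis (mono_tags, lifting) case_prodE fst_conv snd_conv)
  then show "finite (scope S i)" "allowed S i \<subseteq> scope S i \<rightarrow>\<^sub>E {..<k}"
    using assms(1) unfolding constraint_system_def by (blast intro: finite_subset)+
qed

lemma finite_conflicts:
  assumes "constraint_system k S"
  shows "finite (conflicts S)"
proof -
  let ?n = "num_constraints S"
  let ?P = "\<Union>i<?n. allowed S i"
  have "finite (allowed S i)" if "i < ?n" for i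
    using constraint_systemD[OF assms that] by (auto intro: finite_subset simp: finite_PiE)
  then have "finite ({..<?n} \<times> {..<?n} \<times> ?P \<times> ?P)" by auto
  then show ?thesis by (rule rev_finite_subset) (auto simp: conflicts_def)
qed

lemma coordinates_component:
  assumes "0 < k" "constraint_system k S" "i < num_constraints S"
  shows "coordinates (constraint_algebra k (scope S i) (allowed S i)) (allowed S i)
    (\<lambda>\<phi>. constraint_ideal k (scope S i) (allowed S i) +>\<^bsub>cyc_algebra k (scope S i)\<^esub> Phi k (scope S i) \<phi>)
    (\<lambda>\<phi>. quot_character (cyc_eval k \<phi>))"
  using assms constraint_systemD[OF assms(2,3)]
  by (intro cyclic_algebra.coordinates_constraint_algebra cyclic_algebra.intro)

lemma plain_component:
  assumes "0 < k" "constraint_system k S" "i < num_constraints S"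
  shows "plain_star_algebra (constraint_algebra k (scope S i) (allowed S i))"
  by (rule coordinates.axioms[OF coordinates_component[OF assms]])

lemma plain_cc_algebra:
  assumes "0 < k" "constraint_system k S"
  shows "plain_star_algebra (cc_algebra k S)"
  unfolding cc_algebra_def
  by (rule plain_star_algebra_free_product) (simp add: plain_component[OF assms])

lemma cc_Phi_closed:
  assumes "0 < k" "constraint_system k S" "i < num_constraints S" "\<phi> \<in> allowed S i"
  shows "cc_Phi k S i \<phi> \<in> carrier (cc_algebra k S)"
  unfolding cc_algebra_def cc_Phi_def
  by (rule free_product_inj_closed)
    (use assms plain_component[OF assms(1,2)] coordinates.P_closed[OF coordinates_component[OF assms(1-3)]]
     in auto)

text \<open>The weight function is the push-forward of the probabilities along this map, that is, a
  sum over a fibre that can be reindexed.\<close>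

definition conflict_product ::
    "nat \<Rightarrow> 'x csys \<Rightarrow> nat \<times> nat \<times> ('x \<Rightarrow> nat) \<times> ('x \<Rightarrow> nat) \<Rightarrow> 'x cc_elem" where
  "conflict_product k S = (\<lambda>(i, j, \<phi>, \<psi>). cc_Phi k S i \<phi> \<otimes>\<^bsub>cc_algebra k S\<^esub> cc_Phi k S j \<psi>)"

lemma cc_weight_eq:
  "cc_weight k S \<pi> a =
    (\<Sum>t\<in>{t \<in> conflicts S. conflict_product k S t = a}. pmf \<pi> (fst t, fst (snd t)))"
  unfolding cc_weight_def conflict_product_def by (rule sum.cong) (auto simp: split_beta)

lemma weighted_cc_algebra:
  assumes "0 < k" "constraint_system k S"
  shows "weighted_star_algebra (cc_algebra k S) (cc_weight k S \<pi>)"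
proof -
  interpret plain_star_algebra "cc_algebra k S" by (rule plain_cc_algebra[OF assms])
  have "{a \<in> carrier (cc_algebra k S). cc_weight k S \<pi> a \<noteq> 0} \<subseteq>
      conflict_product k S ` conflicts S"
  proof clarify
    fix a assume "cc_weight k S \<pi> a \<noteq> 0"
    then obtain t where "t \<in> {t \<in> conflicts S. conflict_product k S t = a}"
      unfolding cc_weight_eq by (meson sum.not_neutral_contains_not_neutral)
    then show "a \<in> conflict_product k S ` conflicts S" by blast
  qed
  then have "finite {a \<in> carrier (cc_algebra k S). cc_weight k S \<pi> a \<noteq> 0}"
    by (rule finite_subset) (simp add: finite_conflicts[OF assms(2)])
  moreover have "0 \<le> cc_weight k S \<pi> a" for a
    unfolding cc_weight_eq by (intro sum_nonneg) (simp add: split_beta)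
  ultimately show ?thesis
    using star_algebra_plain[OF plain_star_algebra_axioms]
    by (simp add: weighted_star_algebra_def weighted_star_algebra_axioms_def)
qed

section \<open>Weights under isomorphisms\<close>

text \<open>Equal weights make \<open>h\<close> a bijection between the two supports, so the target
  sum is a reindexing of the source sum.\<close>

lemma star_iso_weight_sum:
  assumes "plain_star_algebra A" "plain_star_algebra B" "h \<in> star_iso A B"
    and fin: "finite {a \<in> carrier A. \<mu> a \<noteq> 0}"
    and \<nu>: "\<And>a. a \<in> carrier A \<Longrightarrow> \<nu> (h a) = \<mu> a"
  shows "h (weight_sum A \<mu>) = weight_sum B \<nu>"
proof -
  interpret A: plain_star_algebra A by fact
  interpret B: plain_star_algebra B by fact
  note h = star_isoD[OF assms(3)]
  note hom = star_homD[OF h(1)]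
  let ?S = "{a \<in> carrier A. \<mu> a \<noteq> 0}"
  have S: "{b \<in> carrier B. \<nu> b \<noteq> 0} = h ` ?S"
    unfolding h(3)[symmetric] using \<nu> by auto
  have "h (weight_sum A \<mu>) = (\<Oplus>\<^bsub>B\<^esub>a\<in>?S. h (complex_of_real (\<mu> a) \<odot>\<^bsub>A\<^esub> (adj A a \<otimes>\<^bsub>A\<^esub> a)))"
    unfolding weight_sum_def by (rule star_hom_finsum[OF assms(1,2) h(1) fin]) auto
  also have "\<dots> = (\<Oplus>\<^bsub>B\<^esub>a\<in>?S. complex_of_real (\<nu> (h a)) \<odot>\<^bsub>B\<^esub> (adj B (h a) \<otimes>\<^bsub>B\<^esub> h a))"
    by (rule B.finsum_cong') (auto simp: hom \<nu>)
  also have "\<dots> = weight_sum B \<nu>"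
    unfolding weight_sum_def S
    by (rule B.finsum_reindex[symmetric]) (auto simp: hom intro: inj_on_subset[OF h(2)])
  finally show ?thesis .
qed

lemma (in plain_star_algebra) lesssim_refl:
  assumes "a \<in> carrier A" shows "lesssim A a a"
  unfolding lesssim_def
  \<comment> \<open>Both sums are empty.\<close>
  by (rule exI[of _ 0], rule exI[of _ 0]) (use assms in \<open>simp add: minus_eq r_neg\<close>)

lemma C_homomorphism_star_iso:
  assumes A: "weighted_star_algebra A \<mu>" "plain_star_algebra A"
    and B: "weighted_star_algebra B \<nu>" "plain_star_algebra B"
    and h: "h \<in> star_iso A B" and \<nu>: "\<And>a. a \<in> carrier A \<Longrightarrow> \<nu> (h a) = \<mu> a"
  shows "C_homomorphism 1 A \<mu> B \<nu> h"
proof -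
  interpret B: plain_star_algebra B by fact
  have "h (weight_sum A \<mu>) = weight_sum B \<nu>"
    using A(1) \<nu> unfolding weighted_star_algebra_def weighted_star_algebra_axioms_def
    by (intro star_iso_weight_sum[OF A(2) B(2) h]) auto
  moreover have "weight_sum B \<nu> \<in> carrier B"
    unfolding weight_sum_def by (intro B.finsum_closed) auto
  ultimately show ?thesis
    using A B star_isoD(1)[OF h] B.lesssim_refl by (simp add: C_homomorphism_def)
qed

section \<open>Comparison of a system with its boolean form\<close>

context
  fixes k :: nat and S :: "'x csys"
  assumes system: "constraint_system k S"
begin

abbreviation "bool_conflict \<equiv>
  (\<lambda>(i, j, \<phi>, \<psi>). (i, j, bool_assignment k (scope S i) \<phi>, bool_assignment k (scope S j) \<psi>))"

lemma boolean_form_simps: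
  "num_constraints (boolean_form k S) = num_constraints S"
  "i < num_constraints S \<Longrightarrow> scope (boolean_form k S) i = scope S i \<times> {..<k}"
  "i < num_constraints S \<Longrightarrow>
    allowed (boolean_form k S) i = bool_assignment k (scope S i) ` allowed S i"
  by (simp_all add: boolean_form_def split_beta)

text \<open>Allowed assignments of the boolean form are images by definition, and two of its scopes
  meet in the old intersection times \<open>{..<k}\<close>, so
  \<open>bool_assignment_restrict_eq_iff\<close> decides conflicts.\<close>

lemma conflicts_boolean_form: "conflicts (boolean_form k S) = bool_conflict ` conflicts S"
proof -
  have iff: "(i, j, bool_assignment k (scope S i) \<phi>, bool_assignment k (scope S j) \<psi>)
        \<in> conflicts (boolean_form k S) \<longleftrightarrow> (i, j, \<phi>, \<psi>) \<in> conflicts S"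
    if "i < num_constraints S" "j < num_constraints S" "\<phi> \<in> allowed S i" "\<psi> \<in> allowed S j" for i j \<phi> \<psi>
  proof -
    have "\<phi> \<in> scope S i \<rightarrow>\<^sub>E {..<k}" "\<psi> \<in> scope S j \<rightarrow>\<^sub>E {..<k}"
      using constraint_systemD(2)[OF system] that by auto
    from bool_assignment_restrict_eq_iff[OF this order.refl] show ?thesis
      using that by (simp add: conflicts_def boolean_form_simps Times_Int_distrib1[symmetric] image_iff)
        (auto simp flip: Sigma_Int_distrib1)
  qed
  show ?thesis
  proof (intro subset_antisym subsetI)
    fix t assume t: "t \<in> conflicts (boolean_form k S)"
    obtain i j \<phi>' \<psi>' where eq: "t = (i, j, \<phi>', \<psi>')" by (cases t)
    with t have ij: "i < num_constraints S" "j < num_constraints S"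
      by (auto simp: conflicts_def boolean_form_simps(1))
    with t eq obtain \<phi> \<psi> where "\<phi> \<in> allowed S i" "\<psi> \<in> allowed S j"
      "t = bool_conflict (i, j, \<phi>, \<psi>)"
      by (auto simp: conflicts_def boolean_form_simps)
    then show "t \<in> bool_conflict ` conflicts S"
      using t iff ij by (intro image_eqI[of _ _ "(i, j, \<phi>, \<psi>)"]) auto
  next
    fix t assume "t \<in> bool_conflict ` conflicts S"
    then show "t \<in> conflicts (boolean_form k S)"
      using iff by (auto simp: conflicts_def)
  qed
qed

text \<open>Ensures that reindexing the weights does not merge conflicts.\<close>

lemma inj_on_bool_conflict: "inj_on bool_conflict (conflicts S)"
proof (rule inj_onI)
  fix s t
  assume c: "s \<in> conflicts S" "t \<in> conflicts S" and eq: "bool_conflict s = bool_conflict t"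
  obtain i j \<phi> \<psi> where s: "s = (i, j, \<phi>, \<psi>)" by (cases s)
  then obtain \<phi>' \<psi>' where t: "t = (i, j, \<phi>', \<psi>')" using eq by (cases t) auto
  have "\<phi> \<in> scope S i \<rightarrow>\<^sub>E {..<k}" "\<phi>' \<in> scope S i \<rightarrow>\<^sub>E {..<k}"
    "\<psi> \<in> scope S j \<rightarrow>\<^sub>E {..<k}" "\<psi>' \<in> scope S j \<rightarrow>\<^sub>E {..<k}"
    using c constraint_systemD(2)[OF system] unfolding s t conflicts_def by blast+
  with eq show "s = t"
    by (auto simp: s t dest: inj_onD[OF inj_on_bool_assignment])
qed

lemma boolean_form_iso:
  assumes k: "0 < k"
  obtains \<alpha> where "\<alpha> \<in> star_iso (cc_algebra 2 (boolean_form k S)) (cc_algebra k S)"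
    and "\<And>i \<phi>. \<lbrakk>i < num_constraints S; \<phi> \<in> allowed S i\<rbrakk> \<Longrightarrow>
      \<alpha> (cc_Phi 2 (boolean_form k S) i (bool_assignment k (scope S i) \<phi>)) = cc_Phi k S i \<phi>"
proof -
  let ?T = "boolean_form k S" and ?n = "num_constraints S"
  note system' = constraint_system_boolean_form[OF system]
  let ?A = "\<lambda>i. constraint_algebra k (scope S i) (allowed S i)"
  let ?B = "\<lambda>i. constraint_algebra 2 (scope ?T i) (allowed ?T i)"
  let ?P = "\<lambda>i \<phi>. constraint_ideal k (scope S i) (allowed S i) +>\<^bsub>cyc_algebra k (scope S i)\<^esub> Phi k (scope S i) \<phi>"
  let ?R = "\<lambda>i \<phi>. constraint_ideal 2 (scope ?T i) (allowed ?T i) +>\<^bsub>cyc_algebra 2 (scope ?T i)\<^esub> Phi 2 (scope ?T i) \<phi>"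
  \<comment> \<open>The same coordinate description is used for both systems, once with
    \<open>k\<close> and once with 2.\<close>
  have coords: "coordinates (?A i) (allowed S i) (?P i) (\<lambda>\<phi>. quot_character (cyc_eval k \<phi>))"
    "coordinates (?B i) (allowed ?T i) (?R i) (\<lambda>\<phi>. quot_character (cyc_eval 2 \<phi>))" if "i < ?n" for i
    using that coordinates_component[OF k system] coordinates_component[OF _ system', of i]
    by (simp_all add: boolean_form_simps(1))
  have "\<exists>h. h \<in> star_iso (?B i) (?A i) \<and>
      (\<forall>\<phi>\<in>allowed S i. h (?R i (bool_assignment k (scope S i) \<phi>)) = ?P i \<phi>)" if i: "i < ?n" for i
  proof -
    let ?b = "bool_assignment k (scope S i)"
    have inj: "inj_on ?b (allowed S i)"
      using inj_on_subset[OF inj_on_bool_assignment constraint_systemD(2)[OF system i]] .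
    \<comment> \<open>The isomorphism starts at the boolean form, so the bijection of points is the
      inverse of passing to boolean assignments.\<close>
    then have "bij_betw (inv_into (allowed S i) ?b) (allowed ?T i) (allowed S i)"
      by (intro bij_betw_inv_into) (simp add: bij_betw_def boolean_form_simps(3)[OF i])
    then obtain h where h: "h \<in> star_iso (?B i) (?A i)"
      "\<And>\<phi>. \<phi> \<in> allowed ?T i \<Longrightarrow> h (?R i \<phi>) = ?P i (inv_into (allowed S i) ?b \<phi>)"
      using coordinates_iso[OF coords(2)[OF i] coords(1)[OF i]] by metis
    have "h (?R i (?b \<phi>)) = ?P i \<phi>" if "\<phi> \<in> allowed S i" for \<phi>
      using that h(2)[of "?b \<phi>"] inj by (simp add: boolean_form_simps(3)[OF i])
    with h(1) show ?thesis by blast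
  qed
  then obtain h where h: "\<And>i. i < ?n \<Longrightarrow> h i \<in> star_iso (?B i) (?A i)"
    and hP: "\<And>i \<phi>. \<lbrakk>i < ?n; \<phi> \<in> allowed S i\<rbrakk> \<Longrightarrow> h i (?R i (bool_assignment k (scope S i) \<phi>)) = ?P i \<phi>"
    by metis
  have plain: "plain_star_algebra (?B i)" "plain_star_algebra (?A i)" if "i \<in> {..<?n}" for i
    using that coordinates.axioms[OF coords(1)] coordinates.axioms[OF coords(2)] by auto
  obtain \<alpha> where \<alpha>: "\<alpha> \<in> star_iso (free_product {..<?n} ?B) (free_product {..<?n} ?A)"
    and \<alpha>_inj: "\<And>i a. \<lbrakk>i \<in> {..<?n}; a \<in> carrier (?B i)\<rbrakk> \<Longrightarrow>
      \<alpha> (free_product_inj {..<?n} ?B i a) = free_product_inj {..<?n} ?A i (h i a)"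
    using free_product_iso[where A = ?B and B = ?A and I = "{..<?n}" and h = h] plain h by auto
  show thesis
  proof (rule that)
    show "\<alpha> \<in> star_iso (cc_algebra 2 ?T) (cc_algebra k S)"
      using \<alpha> by (simp add: cc_algebra_def boolean_form_simps(1))
    fix i \<phi> assume i: "i < ?n" and \<phi>: "\<phi> \<in> allowed S i"
    then have "bool_assignment k (scope S i) \<phi> \<in> allowed ?T i"
      by (simp add: boolean_form_simps(3))
    then show "\<alpha> (cc_Phi 2 ?T i (bool_assignment k (scope S i) \<phi>)) = cc_Phi k S i \<phi>"
      using \<alpha>_inj[of i] coordinates.P_closed[OF coords(2)[OF i]] hP[OF i \<phi>] i
      by (simp add: cc_Phi_def boolean_form_simps(1))
  qed
qed

text \<open>By injectivity of \<open>\<alpha>\<close>, a product over the boolean form equals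
  \<open>a\<close> exactly when the corresponding product over \<open>S\<close> equals
  \<open>\<alpha> a\<close>. So the fibres correspond, and the indices \<open>i\<close>,
  \<open>j\<close> that determine the probability are kept.\<close>

lemma boolean_form_weight:
  assumes k: "0 < k"
    and \<alpha>: "\<alpha> \<in> star_iso (cc_algebra 2 (boolean_form k S)) (cc_algebra k S)"
    and \<alpha>_Phi: "\<And>i \<phi>. \<lbrakk>i < num_constraints S; \<phi> \<in> allowed S i\<rbrakk> \<Longrightarrow>
      \<alpha> (cc_Phi 2 (boolean_form k S) i (bool_assignment k (scope S i) \<phi>)) = cc_Phi k S i \<phi>"
    and a: "a \<in> carrier (cc_algebra 2 (boolean_form k S))"
  shows "cc_weight k S \<pi> (\<alpha> a) = cc_weight 2 (boolean_form k S) \<pi> a"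
proof -
  let ?T = "boolean_form k S"
  let ?M = "conflict_product k S" and ?N = "conflict_product 2 ?T"
  interpret T: plain_star_algebra "cc_algebra 2 ?T"
    by (rule plain_cc_algebra[OF _ constraint_system_boolean_form[OF system]]) simp
  note h = star_isoD[OF \<alpha>]
  have N: "?N (bool_conflict t) \<in> carrier (cc_algebra 2 ?T) \<and> \<alpha> (?N (bool_conflict t)) = ?M t"
    if "t \<in> conflicts S" for t
  proof -
    obtain i j \<phi> \<psi> where t: "t = (i, j, \<phi>, \<psi>)" by (cases t)
    have *: "i < num_constraints S" "j < num_constraints S" "\<phi> \<in> allowed S i" "\<psi> \<in> allowed S j"
      using that t by (auto simp: conflicts_def)
    have "cc_Phi 2 ?T i (bool_assignment k (scope S i) \<phi>) \<in> carrier (cc_algebra 2 ?T)"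
      "cc_Phi 2 ?T j (bool_assignment k (scope S j) \<psi>) \<in> carrier (cc_algebra 2 ?T)"
      using * by (auto intro!: cc_Phi_closed constraint_system_boolean_form[OF system]
          simp: boolean_form_simps)
    then show ?thesis using * by (simp add: t conflict_product_def star_homD(4)[OF h(1)] \<alpha>_Phi)
  qed
  have "?N (bool_conflict t) = a \<longleftrightarrow> ?M t = \<alpha> a" if "t \<in> conflicts S" for t
    using inj_on_eq_iff[OF h(2) conjunct1[OF N[OF that]] a] conjunct2[OF N[OF that]] by (simp only:)
  then have sets: "{t \<in> conflicts ?T. ?N t = a} = bool_conflict ` {t \<in> conflicts S. ?M t = \<alpha> a}"
    unfolding conflicts_boolean_form by blast
  have "cc_weight 2 ?T \<pi> a = (\<Sum>t\<in>{t \<in> conflicts ?T. ?N t = a}. pmf \<pi> (fst t, fst (snd t)))"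
    by (rule cc_weight_eq)
  also have "\<dots> = (\<Sum>t\<in>{t \<in> conflicts S. ?M t = \<alpha> a}. pmf \<pi> (fst t, fst (snd t)))"
    unfolding sets
    by (subst sum.reindex) (auto intro: inj_on_subset[OF inj_on_bool_conflict] simp: split_beta)
  also have "\<dots> = cc_weight k S \<pi> (\<alpha> a)"
    by (rule cc_weight_eq[symmetric])
  finally show ?thesis by simp
qed

end

theorem lemma3p5:
  fixes k :: nat and S :: "'x csys" and \<pi> :: "(nat \<times> nat) pmf"
  assumes "1 \<le> k"
    and "constraint_system k S"
    and "set_pmf \<pi> \<subseteq> {..<num_constraints S} \<times> {..<num_constraints S}"
  shows "\<exists>\<alpha> \<in> star_iso (cc_algebra 2 (boolean_form k S)) (cc_algebra k S).
     C_homomorphism 1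
       (cc_algebra 2 (boolean_form k S)) (cc_weight 2 (boolean_form k S) \<pi>)
       (cc_algebra k S) (cc_weight k S \<pi>) \<alpha> \<and>
     C_homomorphism 1
       (cc_algebra k S) (cc_weight k S \<pi>)
       (cc_algebra 2 (boolean_form k S)) (cc_weight 2 (boolean_form k S) \<pi>)
       (inv_into (carrier (cc_algebra 2 (boolean_form k S))) \<alpha>)"
proof -
  have k: "0 < k" using assms(1) by simp
  note S = assms(2) and T = constraint_system_boolean_form[OF assms(2)]
  let ?A = "cc_algebra k S" and ?B = "cc_algebra 2 (boolean_form k S)"
  have A: "weighted_star_algebra ?A (cc_weight k S \<pi>)" "plain_star_algebra ?A"
    using weighted_cc_algebra[OF k S] plain_cc_algebra[OF k S] .
  have B: "weighted_star_algebra ?B (cc_weight 2 (boolean_form k S) \<pi>)" "plain_star_algebra ?B"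
    using weighted_cc_algebra[OF _ T] plain_cc_algebra[OF _ T] by simp_all
  obtain \<alpha> where \<alpha>: "\<alpha> \<in> star_iso ?B ?A"
    and Phi: "\<And>i \<phi>. \<lbrakk>i < num_constraints S; \<phi> \<in> allowed S i\<rbrakk> \<Longrightarrow>
      \<alpha> (cc_Phi 2 (boolean_form k S) i (bool_assignment k (scope S i) \<phi>)) = cc_Phi k S i \<phi>"
    using boolean_form_iso[OF S k] by metis
  have weight: "cc_weight k S \<pi> (\<alpha> b) = cc_weight 2 (boolean_form k S) \<pi> b" if "b \<in> carrier ?B" for b
    by (rule boolean_form_weight[OF S k \<alpha> _ that]) (rule Phi)
  let ?\<beta> = "inv_into (carrier ?B) \<alpha>"
  have \<beta>: "\<alpha> (?\<beta> a) = a" "?\<beta> a \<in> carrier ?B" if "a \<in> carrier ?A" for a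
    using star_isoD(3)[OF \<alpha>] that by (simp_all add: f_inv_into_f inv_into_into)
  \<comment> \<open>The weight identity for the inverse is the one for \<open>\<alpha>\<close>, read
    at the preimage of \<open>a\<close>.\<close>
  have "cc_weight 2 (boolean_form k S) \<pi> (?\<beta> a) = cc_weight k S \<pi> a" if "a \<in> carrier ?A" for a
    using weight[OF \<beta>(2)[OF that]] \<beta>(1)[OF that] by simp
  then show ?thesis
    using C_homomorphism_star_iso[OF B A \<alpha> weight]
      C_homomorphism_star_iso[OF A B star_iso_inv[OF B(2) A(2) \<alpha>]] \<alpha> by blast
qed

end
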